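(* Let $\mathfrak{g}$ be a complex semi-simple Lie algebra of rank $r$ and $V(\lambda)$ a fixed irreducible representation of $\mathfrak{g}$. Let $m_{\lambda,N}$ be the weight multiplicity function of the $N$-th symmetric power $S^N V(\lambda)$, and let $\mu\in X$ be a fixed weight. Then the formal power series $\sum_{N=0}^\infty z^N m_{\lambda,N}(\mu)$ is a holomorphic function in the variable $z$ on $|z|\le R<1$ (for every such $R$). Moreover, we have the identity $$\sum_{N=0}^\infty z^N m_{\lambda,N}(\mu)=\frac{1}{(2\pi)^r}\int_{T^r}e^{-i\langle\mu,x\rangle}\prod_{\nu\in X}\frac{1}{(1-e^{i\langle\nu,x\rangle}z)^{m_{\lambda,1}(\nu)}}\,dx.$$
   Context: $X=\bigoplus_{i=1}^r\mathbb{Z}\omega_i$ is the weight lattice of $\mathfrak{g}$ (with respect to a fixed Cartan subalgebra $\mathfrak{h}$ and Borel subalgebra), spanned by the fundamental weights; $\mathfrak{h}_{\mathbb{R}}$ is the real span of the simple coroots $\alpha_1^\vee,\ldots,\alpha_r^\vee$. $V(\lambda)$ is the irreducible representation of highest weight $\lambda$ (dominant). For $\nu\in X$, $m_{\lambda,N}(\nu)$ is the dimension of the $\nu$-weight space of $S^NV(\lambda)$; in particular $m_{\lambda,1}(\nu)=\dim V(\lambda)_\nu$. $T^r=\mathfrak{h}_{\mathbb{R}}/2\pi X^*$, where $X^*\subset\mathfrak{h}_{\mathbb{R}}$ is the lattice dual to $X$ (the lattice spanned by the simple coroots), and $dx$ is Lebesgue measure on $\mathfrak{h}_{\mathbb{R}}$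 normalized so that the torus $T^r$ has volume $(2\pi)^r$. The product over $X$ has only finitely many factors different from $1$. *)

theory Defs
  imports "HOL-Analysis.Analysis" "HOL-Library.Poly_Mapping" "HOL-Library.Multiset"
begin

section \<open>Complex vector spaces\<close>

class complex_vector = ab_group_add +
  fixes scaleC :: "complex \<Rightarrow> 'a \<Rightarrow> 'a"  (infixr "*\<^sub>C" 75)
  assumes scaleC_add_right: "c *\<^sub>C (x + y) = c *\<^sub>C x + c *\<^sub>C y"
    and scaleC_add_left: "(c + d) *\<^sub>C x = c *\<^sub>C x + d *\<^sub>C x"
    and scaleC_scaleC: "c *\<^sub>C (d *\<^sub>C x) = (c * d) *\<^sub>C x"
    and scaleC_one: "1 *\<^sub>C x = x"

global_interpretation complex_vector: vector_space "scaleC :: complex \<Rightarrow> 'a \<Rightarrow> 'a::complex_vector"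
  by unfold_locales (simp_all add: scaleC_add_right scaleC_add_left scaleC_scaleC scaleC_one)

instantiation complex :: complex_vector
begin

definition scaleC_complex :: "complex \<Rightarrow> complex \<Rightarrow> complex"
  where "scaleC_complex c x = c * x"

instance
  by standard (simp_all add: scaleC_complex_def algebra_simps)

end

instantiation poly_mapping :: (type, complex_vector) complex_vector
begin

definition scaleC_poly_mapping :: "complex \<Rightarrow> ('a \<Rightarrow>\<^sub>0 'b) \<Rightarrow> ('a \<Rightarrow>\<^sub>0 'b)"
  where "scaleC_poly_mapping c p = Poly_Mapping.map (scaleC c) p"

lemma lookup_scaleC:
  fixes p :: "'a \<Rightarrow>\<^sub>0 'b"
  shows "Poly_Mapping.lookup (c *\<^sub>C p) k = c *\<^sub>C Poly_Mapping.lookup p k"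
  by (simp add: scaleC_poly_mapping_def Poly_Mapping.map.rep_eq when_def)

instance
  by standard
    (simp_all add: poly_mapping_eq_iff fun_eq_iff lookup_scaleC lookup_add
      scaleC_add_right scaleC_add_left scaleC_scaleC scaleC_one)

end

definition finite_dim :: "'a::complex_vector set \<Rightarrow> bool"
  where "finite_dim S \<longleftrightarrow> (\<exists>B. finite B \<and> S \<subseteq> complex_vector.span B)"

text \<open>
  The dimension of \<open>W / R\<close>, for subspaces \<open>R \<subseteq> W\<close> with finite-dimensional quotient: the number
  of elements of any finite set \<open>B \<subseteq> W\<close> that is mapped bijectively to a basis of \<open>W / R\<close>.
\<close>

definition quot_basis :: "'a::complex_vector set \<Rightarrow> 'a set \<Rightarrow> 'a set \<Rightarrow> bool"
  where "quot_basis W R B \<longleftrightarrow>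
    finite B \<and> B \<subseteq> W \<and> W \<subseteq> complex_vector.span (B \<union> R) \<and>
    (\<forall>c. (\<Sum>b\<in>B. c b *\<^sub>C b) \<in> R \<longrightarrow> (\<forall>b\<in>B. c b = 0))"

definition quot_dim :: "'a::complex_vector set \<Rightarrow> 'a set \<Rightarrow> nat"
  where "quot_dim W R = (THE n. \<exists>B. quot_basis W R B \<and> card B = n)"

lemma quot_basis_card_le:
  fixes R :: "'a::complex_vector set"
  assumes R: "complex_vector.subspace R" and B: "quot_basis W R B" and B': "quot_basis W R B'"
  shows "card B \<le> card B'"
proof -
  have fin: "finite B" "finite B'" and BW: "B \<subseteq> complex_vector.span (B' \<union> R)"
    and ind: "\<And>c. (\<Sum>b\<in>B. c b *\<^sub>C b) \<in> R \<Longrightarrow> \<forall>b\<in>B. c b = 0"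
    using B B' by (auto simp: quot_basis_def)
  obtain C where C: "C \<subseteq> R" "complex_vector.independent C" "R \<subseteq> complex_vector.span C"
    using complex_vector.maximal_independent_subset[of R] by blast
  have "B' \<union> R \<subseteq> complex_vector.span (B' \<union> C)"
    using C(3) complex_vector.span_mono[of C "B' \<union> C"] complex_vector.span_superset[of "B' \<union> C"]
    by blast
  then have "B \<subseteq> complex_vector.span (B' \<union> C)"
    using BW complex_vector.span_minimal[OF _ complex_vector.subspace_span] by blast
  moreover have "\<exists>T. finite T \<and> T \<subseteq> B' \<union> C \<and> b \<in> complex_vector.span T"
    if "b \<in> complex_vector.span (B' \<union> C)" for b
  proof -
    from that obtain T u where T: "finite T" "T \<subseteq> B' \<union> C" and b: "b = (\<Sum>a\<in>T. u a *\<^sub>C a)"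
      by (auto simp: complex_vector.span_explicit)
    have "b \<in> complex_vector.span T"
      unfolding b
      by (intro complex_vector.span_sum complex_vector.span_scale complex_vector.span_base)
    with T show ?thesis by blast
  qed
  ultimately have "\<forall>b\<in>B. \<exists>T. finite T \<and> T \<subseteq> B' \<union> C \<and> b \<in> complex_vector.span T"
    by blast
  then obtain T where T: "\<forall>b\<in>B. finite (T b) \<and> T b \<subseteq> B' \<union> C \<and> b \<in> complex_vector.span (T b)"
    by (rule bchoice[THEN exE])
  define D where "D = (\<Union>b\<in>B. T b) \<inter> C"
  have D: "finite D" "D \<subseteq> C"
    using T fin by (auto simp: D_def)
  have sub: "B \<subseteq> complex_vector.span (B' \<union> D)"
  proof
    fix b assume b: "b \<in> B"
    then have "T b \<subseteq> B' \<union> D" using T by (auto simp: D_def)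
    then show "b \<in> complex_vector.span (B' \<union> D)"
      using T b complex_vector.span_mono by blast
  qed
  have DR: "complex_vector.span D \<subseteq> R"
    using D(2) C(1) R by (intro complex_vector.span_minimal) auto
  have iD: "complex_vector.independent D"
    using C(2) D(2) complex_vector.independent_mono by blast
  have disj: "B \<inter> D = {}"
  proof (rule ccontr)
    assume "B \<inter> D \<noteq> {}"
    then obtain b where b: "b \<in> B" "b \<in> R" using D(2) C(1) by blast
    have "(\<Sum>x\<in>B. (if x = b then 1 else 0) *\<^sub>C x) = (\<Sum>x\<in>B. if x = b then x else 0)"
      by (intro sum.cong) (auto simp: scaleC_one)
    also have "\<dots> = b" using b fin by simp
    finally have "(\<Sum>x\<in>B. (if x = b then 1 else 0) *\<^sub>C x) \<in> R" using b by simp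
    from ind[OF this] b show False by auto
  qed
  have indep: "complex_vector.independent (B \<union> D)"
  proof (rule complex_vector.independent_if_scalars_zero)
    show "finite (B \<union> D)" using fin D by simp
    fix f x assume z: "(\<Sum>x\<in>B \<union> D. f x *\<^sub>C x) = 0" and x: "x \<in> B \<union> D"
    have split: "(\<Sum>x\<in>B. f x *\<^sub>C x) + (\<Sum>x\<in>D. f x *\<^sub>C x) = 0"
      using z sum.union_disjoint[OF fin(1) D(1) disj, of "\<lambda>x. f x *\<^sub>C x"] by simp
    have "(\<Sum>x\<in>D. f x *\<^sub>C x) \<in> R"
      by (intro subsetD[OF DR] complex_vector.span_sum complex_vector.span_scale
          complex_vector.span_base)
    then have "- (\<Sum>x\<in>D. f x *\<^sub>C x) \<in> R"
      by (rule complex_vector.subspace_neg[OF R])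
    then have "(\<Sum>x\<in>B. f x *\<^sub>C x) \<in> R"
      using split by (simp add: eq_neg_iff_add_eq_0[symmetric])
    from ind[OF this] have fB: "\<forall>x\<in>B. f x = 0" .
    then have "(\<Sum>x\<in>D. f x *\<^sub>C x) = 0" using split by simp
    then have "\<forall>x\<in>D. f x = 0"
      using iD D(1) complex_vector.dependent_finite[OF D(1)] by blast
    with fB x show "f x = 0" by blast
  qed
  have "B \<union> D \<subseteq> complex_vector.span (B' \<union> D)"
    using sub complex_vector.span_superset[of "B' \<union> D"] by blast
  then have "card (B \<union> D) \<le> card (B' \<union> D)"
    using complex_vector.independent_span_bound[OF _ indep] fin D by blast
  also have "\<dots> \<le> card B' + card D" by (rule card_Un_le)
  finally show ?thesis
    using card_Un_disjoint[OF fin(1) D(1) disj] by simp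
qed

lemma quot_dim_eq_card:
  assumes "complex_vector.subspace R" and "quot_basis W R B"
  shows "quot_dim W R = card B"
  unfolding quot_dim_def
  using assms by (intro the_equality) (auto intro: antisym quot_basis_card_le)


section \<open>Complex Lie algebras\<close>

class lie_algebra = complex_vector +
  fixes lie_bracket :: "'a \<Rightarrow> 'a \<Rightarrow> 'a"
  assumes lie_bracket_add_left: "lie_bracket (x + y) z = lie_bracket x z + lie_bracket y z"
    and lie_bracket_add_right: "lie_bracket x (y + z) = lie_bracket x y + lie_bracket x z"
    and lie_bracket_scaleC_left: "lie_bracket (c *\<^sub>C x) y = c *\<^sub>C lie_bracket x y"
    and lie_bracket_scaleC_right: "lie_bracket x (c *\<^sub>C y) = c *\<^sub>C lie_bracket x y"
    and lie_bracket_self: "lie_bracket x x = 0"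
    and lie_bracket_jacobi:
      "lie_bracket x (lie_bracket y z) + lie_bracket y (lie_bracket z x)
        + lie_bracket z (lie_bracket x y) = 0"

definition lie_subalgebra :: "'g::lie_algebra set \<Rightarrow> bool"
  where "lie_subalgebra A \<longleftrightarrow>
    complex_vector.subspace A \<and> (\<forall>x\<in>A. \<forall>y\<in>A. lie_bracket x y \<in> A)"

definition lie_ideal :: "'g::lie_algebra set \<Rightarrow> bool"
  where "lie_ideal A \<longleftrightarrow> complex_vector.subspace A \<and> (\<forall>x. \<forall>y\<in>A. lie_bracket x y \<in> A)"

primrec derived_series :: "'g::lie_algebra set \<Rightarrow> nat \<Rightarrow> 'g set"
  where
    "derived_series A 0 = A"
  | "derived_series A (Suc k) = complex_vector.span
      {lie_bracket x y | x y. x \<in> derived_series A k \<and> y \<in> derived_series A k}"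

definition lie_solvable :: "'g::lie_algebra set \<Rightarrow> bool"
  where "lie_solvable A \<longleftrightarrow> (\<exists>k. derived_series A k = {0})"

definition semisimple :: "'g::lie_algebra itself \<Rightarrow> bool"
  where "semisimple _ \<longleftrightarrow>
    finite_dim (UNIV :: 'g set) \<and>
    (\<forall>I :: 'g set. lie_ideal I \<and> lie_solvable I \<longrightarrow> I = {0})"


section \<open>Representations and weight spaces\<close>

definition lie_representation :: "('g::lie_algebra \<Rightarrow> 'v::complex_vector \<Rightarrow> 'v) \<Rightarrow> bool"
  where "lie_representation \<rho> \<longleftrightarrow>
    (\<forall>x v w. \<rho> x (v + w) = \<rho> x v + \<rho> x w) \<and>
    (\<forall>x c v. \<rho> x (c *\<^sub>C v) = c *\<^sub>C \<rho> x v) \<and>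
    (\<forall>x y v. \<rho> (x + y) v = \<rho> x v + \<rho> y v) \<and>
    (\<forall>c x v. \<rho> (c *\<^sub>C x) v = c *\<^sub>C \<rho> x v) \<and>
    (\<forall>x y v. \<rho> (lie_bracket x y) v = \<rho> x (\<rho> y v) - \<rho> y (\<rho> x v))"

definition irreducible_rep :: "('g::lie_algebra \<Rightarrow> 'v::complex_vector \<Rightarrow> 'v) \<Rightarrow> bool"
  where "irreducible_rep \<rho> \<longleftrightarrow>
    lie_representation \<rho> \<and> (UNIV :: 'v set) \<noteq> {0} \<and>
    (\<forall>U. complex_vector.subspace U \<and> (\<forall>x. \<forall>u\<in>U. \<rho> x u \<in> U) \<longrightarrow> U = {0} \<or> U = UNIV)"

text \<open>
  The dual space of a subspace \<open>h\<close>. Functionals are extended by \<open>0\<close> outside \<open>h\<close>, so that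
  functionals that agree on \<open>h\<close> are equal (and sets of weights have the right cardinality).
\<close>

definition dual_space :: "'g::complex_vector set \<Rightarrow> ('g \<Rightarrow> complex) set"
  where "dual_space h = {\<nu>.
    (\<forall>x\<in>h. \<forall>y\<in>h. \<nu> (x + y) = \<nu> x + \<nu> y) \<and>
    (\<forall>c. \<forall>x\<in>h. \<nu> (c *\<^sub>C x) = c * \<nu> x) \<and>
    (\<forall>x. x \<notin> h \<longrightarrow> \<nu> x = 0)}"

definition weight_space ::
    "'g set \<Rightarrow> ('g \<Rightarrow> 'v::complex_vector \<Rightarrow> 'v) \<Rightarrow> ('g \<Rightarrow> complex) \<Rightarrow> 'v set"
  where "weight_space h \<rho> \<nu> = {v. \<forall>x\<in>h. \<rho> x v = \<nu> x *\<^sub>C v}"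


section \<open>Roots, coroots and weights\<close>

abbreviation root_space :: "'g::lie_algebra set \<Rightarrow> ('g \<Rightarrow> complex) \<Rightarrow> 'g set"
  where "root_space h \<equiv> weight_space h lie_bracket"

text \<open>
  Cartan subalgebras of a semisimple Lie algebra: the maximal ones among the abelian subalgebras
  whose adjoint action is diagonalizable.
\<close>

definition toral :: "'g::lie_algebra set \<Rightarrow> bool"
  where "toral h \<longleftrightarrow>
    complex_vector.subspace h \<and> (\<forall>x\<in>h. \<forall>y\<in>h. lie_bracket x y = 0) \<and>
    complex_vector.span (\<Union>\<alpha>\<in>dual_space h. root_space h \<alpha>) = UNIV"

definition cartan_subalgebra :: "'g::lie_algebra set \<Rightarrow> bool"
  where "cartan_subalgebra h \<longleftrightarrow> toral h \<and> (\<forall>k. toral k \<and> h \<subseteq> k \<longrightarrow> k = h)"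

definition borel_subalgebra :: "'g::lie_algebra set \<Rightarrow> bool"
  where "borel_subalgebra b \<longleftrightarrow>
    lie_subalgebra b \<and> lie_solvable b \<and>
    (\<forall>k. lie_subalgebra k \<and> lie_solvable k \<and> b \<subseteq> k \<longrightarrow> k = b)"

definition roots :: "'g::lie_algebra set \<Rightarrow> ('g \<Rightarrow> complex) set"
  where "roots h = {\<alpha> \<in> dual_space h. \<alpha> \<noteq> (\<lambda>_. 0) \<and> root_space h \<alpha> \<noteq> {0}}"

definition positive_roots :: "'g::lie_algebra set \<Rightarrow> 'g set \<Rightarrow> ('g \<Rightarrow> complex) set"
  where "positive_roots h b = {\<alpha> \<in> roots h. root_space h \<alpha> \<subseteq> b}"

definition simple_roots :: "'g::lie_algebra set \<Rightarrow> 'g set \<Rightarrow> ('g \<Rightarrow> complex) set"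
  where "simple_roots h b = {\<alpha> \<in> positive_roots h b.
    \<not> (\<exists>\<beta>\<in>positive_roots h b. \<exists>\<gamma>\<in>positive_roots h b. \<alpha> = (\<lambda>x. \<beta> x + \<gamma> x))}"

text \<open>
  The coroot of a root \<open>\<alpha>\<close> is the element \<open>c = [e, f]\<close> of any \<open>sl\<^sub>2\<close>-triple \<open>(e, c, f)\<close> with
  \<open>e\<close> in the root space of \<open>\<alpha>\<close> and \<open>f\<close> in that of \<open>-\<alpha>\<close>. In a semisimple Lie algebra it is unique.
\<close>

definition is_coroot :: "'g::lie_algebra set \<Rightarrow> ('g \<Rightarrow> complex) \<Rightarrow> 'g \<Rightarrow> bool"
  where "is_coroot h \<alpha> c \<longleftrightarrow>
    c \<in> h \<and> \<alpha> c = 2 \<and>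
    (\<exists>e\<in>root_space h \<alpha>. \<exists>f\<in>root_space h (\<lambda>x. - \<alpha> x). lie_bracket e f = c)"

definition fundamental_weights ::
    "'g::complex_vector set \<Rightarrow> nat \<Rightarrow> (nat \<Rightarrow> 'g) \<Rightarrow> (nat \<Rightarrow> 'g \<Rightarrow> complex) \<Rightarrow> bool"
  where "fundamental_weights h r \<alpha>c \<omega> \<longleftrightarrow>
    (\<forall>i<r. \<omega> i \<in> dual_space h \<and> (\<forall>j<r. \<omega> i (\<alpha>c j) = (if i = j then 1 else 0)))"

definition weight_lattice :: "nat \<Rightarrow> (nat \<Rightarrow> 'g \<Rightarrow> complex) \<Rightarrow> ('g \<Rightarrow> complex) set"
  where "weight_lattice r \<omega> = {(\<lambda>x. \<Sum>i<r. of_int (n i) * \<omega> i x) | n :: nat \<Rightarrow> int. True}"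

definition dominant_weights :: "nat \<Rightarrow> (nat \<Rightarrow> 'g \<Rightarrow> complex) \<Rightarrow> ('g \<Rightarrow> complex) set"
  where "dominant_weights r \<omega> = {(\<lambda>x. \<Sum>i<r. of_nat (n i) * \<omega> i x) | n :: nat \<Rightarrow> nat. True}"

definition highest_weight ::
    "'g::lie_algebra set \<Rightarrow> 'g set \<Rightarrow> ('g \<Rightarrow> 'v::complex_vector \<Rightarrow> 'v) \<Rightarrow> ('g \<Rightarrow> complex) \<Rightarrow> bool"
  where "highest_weight h b \<rho> lam \<longleftrightarrow>
    (\<exists>v\<in>weight_space h \<rho> lam. v \<noteq> 0 \<and>
      (\<forall>\<alpha>\<in>positive_roots h b. \<forall>e\<in>root_space h \<alpha>. \<rho> e v = 0))"


section \<open>Symmetric powers\<close>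

text \<open>
  The symmetric power \<open>S^N V\<close> is the quotient \<open>sym_free N / sym_rel N\<close>: it is generated by the
  formal commutative products \<open>sym_monomial M = v\<^sub>1 \<cdots> v\<^sub>N\<close>, one for each multiset
  \<open>M = {v\<^sub>1, \<dots>, v\<^sub>N}\<close> of vectors, subject to multilinearity.
\<close>

definition sym_monomial :: "'v multiset \<Rightarrow> 'v multiset \<Rightarrow>\<^sub>0 complex"
  where "sym_monomial M = Poly_Mapping.single M 1"

definition sym_free :: "nat \<Rightarrow> ('v multiset \<Rightarrow>\<^sub>0 complex) set"
  where "sym_free N = complex_vector.span {sym_monomial M | M. size M = N}"

definition sym_rel :: "nat \<Rightarrow> ('v::complex_vector multiset \<Rightarrow>\<^sub>0 complex) set"
  where "sym_rel N = complex_vector.span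
    ({sym_monomial (add_mset (u + v) M) - sym_monomial (add_mset u M) - sym_monomial (add_mset v M)
        | u v M. Suc (size M) = N}
     \<union> {sym_monomial (add_mset (c *\<^sub>C u) M) - c *\<^sub>C sym_monomial (add_mset u M)
        | c u M. Suc (size M) = N})"

text \<open>The linear extension of \<open>x \<cdot> (v\<^sub>1 \<cdots> v\<^sub>N) = (\<Sum>i. v\<^sub>1 \<cdots> (x v\<^sub>i) \<cdots> v\<^sub>N)\<close>.\<close>

definition sym_action ::
    "('g \<Rightarrow> 'v \<Rightarrow> 'v) \<Rightarrow> 'g \<Rightarrow> ('v multiset \<Rightarrow>\<^sub>0 complex) \<Rightarrow> ('v multiset \<Rightarrow>\<^sub>0 complex)"
  where "sym_action \<rho> x p =
    (\<Sum>M\<in>Poly_Mapping.keys p. Poly_Mapping.lookup p M *\<^sub>C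
      (\<Sum>v\<in>#M. sym_monomial (add_mset (\<rho> x v) (M - {#v#}))))"

text \<open>The preimage in \<open>sym_free N\<close> of the \<open>\<nu>\<close>-weight space of \<open>S^N V\<close>.\<close>

definition sym_weight_space ::
    "'g set \<Rightarrow> ('g \<Rightarrow> 'v::complex_vector \<Rightarrow> 'v) \<Rightarrow> nat \<Rightarrow> ('g \<Rightarrow> complex)
      \<Rightarrow> ('v multiset \<Rightarrow>\<^sub>0 complex) set"
  where "sym_weight_space h \<rho> N \<nu> =
    {p \<in> sym_free N. \<forall>x\<in>h. sym_action \<rho> x p - \<nu> x *\<^sub>C p \<in> sym_rel N}"

definition weight_mult ::
    "'g set \<Rightarrow> ('g \<Rightarrow> 'v::complex_vector \<Rightarrow> 'v) \<Rightarrow> nat \<Rightarrow> ('g \<Rightarrow> complex) \<Rightarrow> nat"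
  where "weight_mult h \<rho> N \<nu> = quot_dim (sym_weight_space h \<rho> N \<nu>) (sym_rel N)"


section \<open>Integration over the torus\<close>

text \<open>
  The integral over the quotient of the real span of \<open>c\<^sub>0, \<dots>, c\<^sub>r\<^sub>-\<^sub>1\<close> by \<open>2\<pi>\<close> times their integral
  span of a function \<open>F\<close> that is invariant under that lattice. In the coordinates \<open>t\<close> given by
  the \<open>c\<^sub>i\<close>, a fundamental domain is \<open>[0, 2\<pi>)\<^sup>r\<close>, and the Lebesgue measure for which the torus has
  volume \<open>(2\<pi>)\<^sup>r\<close> is the standard one.
\<close>

definition torus_integral :: "nat \<Rightarrow> (nat \<Rightarrow> 'g::complex_vector) \<Rightarrow> ('g \<Rightarrow> complex) \<Rightarrow> complex"
  where "torus_integral r c F =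
    (LINT t : (PiE {..<r} (\<lambda>_. {0..<2 * pi})) | PiM {..<r} (\<lambda>_. lborel).
      F (\<Sum>i<r. of_real (t i) *\<^sub>C c i))"

end

theory Submission
  imports Defs
begin

text \<open>
  Choose a basis \<open>E\<close> of the representation that consists of weight vectors. The monomials in \<open>E\<close>
  of degree \<open>N\<close>, that is, the multisets of size \<open>N\<close> over \<open>E\<close>, are a basis of the symmetric power,
  and each has as its weight the sum of the weights of its factors. Thus the multiplicity of \<open>\<mu>\<close>
  is the number of multisets of size \<open>N\<close> with total weight \<open>\<mu>\<close> (\<open>weight_mult_eq_card\<close>). Weighting
  every multiset by \<open>z\<^sup>N\<close> and by the character \<open>e\<^bsup>i\<langle>\<nu>,x\<rangle>\<^esup>\<close> of its weight \<open>\<nu>\<close>, the total is a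
  product of geometric series, one for each basis vector (\<open>complete_homogeneous_sums\<close>); grouped by
  weights this is the product under the integral. Multiplying by \<open>e\<^bsup>-i\<langle>\<mu>,x\<rangle>\<^esup>\<close> and integrating over
  the torus keeps exactly the multisets of weight \<open>\<mu>\<close>, by orthogonality of characters
  (\<open>torus_integral_character_series\<close>).

  Convergence for \<open>\<bar>z\<bar> < 1\<close> comes from the majorant obtained by counting all multisets: its
  generating function is \<open>(1 - z)\<close> to the power \<open>- card E\<close>.

  Two facts from Lie theory enter (\<open>weight_basis_exists\<close>). A basis of weight vectors exists since the
  span of all weight vectors is a nonzero subrepresentation. The weights lie in the weight lattice,
  so that they define characters of the torus: the coroots are a basis of the Cartan subalgebra,
  dual to the fundamental weights, and each of them belongs to an \<open>sl\<^sub>2\<close>-triple and so has integral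
  eigenvalues on any finite-dimensional representation.
\<close>

section \<open>A basis of weight vectors\<close>

text \<open>
  For this reason, raising or lowering an eigenvector in a representation of \<open>sl\<^sub>2\<close> ends after
  finitely many steps: each step shifts the eigenvalue by the same nonzero number, so the vectors
  obtained have pairwise different eigenvalues as long as they do not vanish. Applying \<open>T - a\<^sub>n\<close> to a vanishing combination of
  \<open>u\<^sub>0, \<dots>, u\<^sub>n\<close> removes \<open>u\<^sub>n\<close>, which proves independence by induction.
\<close>

lemma distinct_eigenvectors_not_finite_dim:
  fixes T :: "'v::complex_vector \<Rightarrow> 'v" and u :: "nat \<Rightarrow> 'v" and a :: "nat \<Rightarrow> complex"
  assumes add: "\<And>v w. T (v + w) = T v + T w" and scale: "\<And>c v. T (c *\<^sub>C v) = c *\<^sub>C T v"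
    and eig: "\<And>k. T (u k) = a k *\<^sub>C u k" and inj: "inj a" and nz: "\<And>k. u k \<noteq> 0"
  shows "\<not> finite_dim (UNIV :: 'v set)"
proof
  assume "finite_dim (UNIV :: 'v set)"
  then obtain C :: "'v set" where C: "finite C" "UNIV \<subseteq> complex_vector.span C"
    unfolding finite_dim_def by blast
  have T0: "T 0 = 0" using add[of 0 0] by simp
  have Tsum: "T (sum g S) = (\<Sum>k\<in>S. T (g k))" if "finite S" for g :: "nat \<Rightarrow> 'v" and S
    using that by (induction S rule: finite_induct) (simp_all add: T0 add)
  have indep: "\<forall>c. (\<Sum>k<n. c k *\<^sub>C u k) = 0 \<longrightarrow> (\<forall>k<n. c k = 0)" for n
  proof (induction n)
    case (Suc n)
    show ?case
    proof (intro allI impI)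
      fix c k assume z: "(\<Sum>k<Suc n. c k *\<^sub>C u k) = 0" and k: "k < Suc n"
      have "T (\<Sum>k<Suc n. c k *\<^sub>C u k) = (\<Sum>k<Suc n. (c k * a k) *\<^sub>C u k)"
        by (simp add: Tsum add scale eig scaleC_scaleC)
      then have "0 = (\<Sum>k<Suc n. (c k * a k) *\<^sub>C u k) - a n *\<^sub>C (\<Sum>k<Suc n. c k *\<^sub>C u k)"
        using z T0 by simp
      also have "\<dots> = (\<Sum>k<n. (c k * (a k - a n)) *\<^sub>C u k)"
        by (simp add: complex_vector.scale_sum_right scaleC_add_right scaleC_scaleC sum_subtractf
            complex_vector.scale_left_diff_distrib algebra_simps)
      finally have "\<forall>k<n. c k * (a k - a n) = 0" using Suc.IH by metis
      then have c0: "c k = 0" if "k < n" for k using that inj by (auto simp: inj_eq)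
      then have "c n *\<^sub>C u n = 0" using z by (simp add: sum.neutral)
      then have "c n = 0" using nz by simp
      then show "c k = 0" using c0 k less_Suc_eq by auto
    qed
  qed simp
  have "inj u"
  proof (rule injI)
    fix i j assume ij: "u i = u j"
    then have "a i *\<^sub>C u i = a j *\<^sub>C u i" using eig[of i] eig[of j] by metis
    then have "a i = a j" using nz[of i] by simp
    then show "i = j" using inj by (simp add: inj_eq)
  qed
  have "n \<le> card C" for n
  proof -
    have inju: "inj_on u {..<n}" using \<open>inj u\<close> inj_on_subset by blast
    have "complex_vector.independent (u ` {..<n})"
    proof (rule complex_vector.independent_if_scalars_zero)
      fix f x assume z: "(\<Sum>x\<in>u ` {..<n}. f x *\<^sub>C x) = 0" and x: "x \<in> u ` {..<n}"
      have "(\<Sum>k<n. f (u k) *\<^sub>C u k) = 0" using z by (simp add: sum.reindex[OF inju])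
      then have "\<forall>k<n. f (u k) = 0" using indep[of n, rule_format, of "\<lambda>k. f (u k)"] by simp
      then show "f x = 0" using x by auto
    qed simp
    then have "card (u ` {..<n}) \<le> card C"
      using complex_vector.independent_span_bound[OF C(1)] C(2) by blast
    then show ?thesis by (simp add: card_image[OF inju])
  qed
  from this[of "Suc (card C)"] show False by simp
qed

text \<open>
  Raise the eigenvector \<open>v\<close> with \<open>e\<close> until the next step gives \<open>0\<close>: this yields a highest
  weight vector \<open>w\<close>, of eigenvalue \<open>m = a + 2k\<close>. Then lower \<open>w\<close> with \<open>f\<close>. By the commutation
  relations, \<open>e f\<^bsup>j+1\<^esup> w = (j + 1) (m - j) f\<^bsup>j\<^esup> w\<close>, and at the step \<open>j\<close> where the lowering
  stops this forces \<open>m = j\<close>.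
\<close>

lemma sl2_integral_eigenvalue:
  fixes \<rho> :: "'g::lie_algebra \<Rightarrow> 'v::complex_vector \<Rightarrow> 'v"
  assumes rep: "lie_representation \<rho>" and fin: "finite_dim (UNIV :: 'v set)"
    and ce: "lie_bracket c e = 2 *\<^sub>C e" and cf: "lie_bracket c f = (-2) *\<^sub>C f"
    and ef: "lie_bracket e f = c"
    and v: "v \<noteq> 0" "\<rho> c v = a *\<^sub>C v"
  shows "a \<in> \<int>"
proof -
  have add: "\<rho> x (v + w) = \<rho> x v + \<rho> x w" and scale: "\<rho> x (k *\<^sub>C v) = k *\<^sub>C \<rho> x v"
    and lscale: "\<rho> (k *\<^sub>C x) v = k *\<^sub>C \<rho> x v"
    and br: "\<rho> (lie_bracket x y) v = \<rho> x (\<rho> y v) - \<rho> y (\<rho> x v)" for x y v w k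
    using rep by (auto simp: lie_representation_def)
  have zero: "\<rho> x 0 = 0" for x using add[of x 0 0] by simp
  have stops: "\<exists>k. ((\<rho> x ^^ k) w \<noteq> 0) \<and> \<rho> x ((\<rho> x ^^ k) w) = 0"
    if w: "w \<noteq> 0" and d: "d \<noteq> 0" and eig: "\<And>k. \<rho> c ((\<rho> x ^^ k) w) = (m + of_nat k * d) *\<^sub>C (\<rho> x ^^ k) w"
    for x w m d
  proof (rule ccontr)
    assume "\<not> ?thesis"
    then have step: "(\<rho> x ^^ k) w \<noteq> 0 \<Longrightarrow> (\<rho> x ^^ Suc k) w \<noteq> 0" for k by auto
    have nz: "(\<rho> x ^^ k) w \<noteq> 0" for k
      by (induction k) (use w step in \<open>auto simp del: funpow.simps(2)\<close>)
    have "inj (\<lambda>k::nat. m + of_nat k * d)" using d by (auto intro!: injI)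
    from distinct_eigenvectors_not_finite_dim[OF add scale eig this nz] fin show False by blast
  qed
  have e_eig: "\<rho> c ((\<rho> e ^^ k) v) = (a + of_nat k * 2) *\<^sub>C (\<rho> e ^^ k) v" for k
  proof (induction k)
    case (Suc k)
    have "\<rho> c (\<rho> e ((\<rho> e ^^ k) v)) = \<rho> (lie_bracket c e) ((\<rho> e ^^ k) v) + \<rho> e (\<rho> c ((\<rho> e ^^ k) v))"
      using br[of c e] by simp
    also have "\<dots> = 2 *\<^sub>C (\<rho> e ^^ Suc k) v + (a + of_nat k * 2) *\<^sub>C (\<rho> e ^^ Suc k) v"
      by (simp only: Suc ce lscale scale funpow.simps o_apply)
    also have "\<dots> = (a + of_nat (Suc k) * 2) *\<^sub>C (\<rho> e ^^ Suc k) v"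
      by (subst scaleC_add_left[symmetric]) (rule arg_cong[where f = "\<lambda>t. t *\<^sub>C _"], simp)
    finally show ?case by simp
  qed (simp add: v)
  have "\<exists>k. (\<rho> e ^^ k) v \<noteq> 0 \<and> \<rho> e ((\<rho> e ^^ k) v) = 0"
    by (rule stops[OF v(1) _ e_eig]) simp
  then obtain k where k: "(\<rho> e ^^ k) v \<noteq> 0" "\<rho> e ((\<rho> e ^^ k) v) = 0" by blast
  define w where "w = (\<rho> e ^^ k) v"
  define m where "m = a + of_nat k * 2"
  have w: "w \<noteq> 0" "\<rho> e w = 0" "\<rho> c w = m *\<^sub>C w"
    using k e_eig by (auto simp: w_def m_def)
  have f_eig: "\<rho> c ((\<rho> f ^^ j) w) = (m + of_nat j * (-2)) *\<^sub>C (\<rho> f ^^ j) w" for j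
  proof (induction j)
    case (Suc j)
    have "\<rho> c (\<rho> f ((\<rho> f ^^ j) w)) = \<rho> (lie_bracket c f) ((\<rho> f ^^ j) w) + \<rho> f (\<rho> c ((\<rho> f ^^ j) w))"
      using br[of c f] by simp
    also have "\<dots> = (-2) *\<^sub>C (\<rho> f ^^ Suc j) w + (m + of_nat j * (-2)) *\<^sub>C (\<rho> f ^^ Suc j) w"
      by (simp only: Suc cf lscale scale funpow.simps o_apply)
    also have "\<dots> = (m + of_nat (Suc j) * (-2)) *\<^sub>C (\<rho> f ^^ Suc j) w"
      by (subst scaleC_add_left[symmetric]) (rule arg_cong[where f = "\<lambda>t. t *\<^sub>C _"], simp)
    finally show ?case by simp
  qed (simp add: w)
  have ef_eig: "\<rho> e ((\<rho> f ^^ Suc j) w) = (of_nat (Suc j) * (m - of_nat j)) *\<^sub>C (\<rho> f ^^ j) w" for j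
  proof (induction j)
    case 0
    have "\<rho> e (\<rho> f w) = \<rho> c w + \<rho> f (\<rho> e w)" using br[of e f w] by (simp add: ef)
    then show ?case by (simp add: w zero)
  next
    case (Suc j)
    let ?u = "(\<rho> f ^^ Suc j) w"
    have "\<rho> e (\<rho> f ?u) = \<rho> c ?u + \<rho> f (\<rho> e ?u)" using br[of e f ?u] by (simp add: ef)
    also have "\<dots> = (m + of_nat (Suc j) * (-2)) *\<^sub>C ?u + (of_nat (Suc j) * (m - of_nat j)) *\<^sub>C ?u"
      by (subst f_eig, subst Suc) (simp add: scale)
    also have "\<dots> = (of_nat (Suc (Suc j)) * (m - of_nat (Suc j))) *\<^sub>C ?u"
      by (subst scaleC_add_left[symmetric]) (rule arg_cong[where f = "\<lambda>t. t *\<^sub>C ?u"], simp add: algebra_simps)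
    finally show ?case by simp
  qed
  have "\<exists>j. (\<rho> f ^^ j) w \<noteq> 0 \<and> \<rho> f ((\<rho> f ^^ j) w) = 0"
    by (rule stops[OF w(1) _ f_eig]) simp
  then obtain j where j: "(\<rho> f ^^ j) w \<noteq> 0" "\<rho> f ((\<rho> f ^^ j) w) = 0" by blast
  have "(of_nat (Suc j) * (m - of_nat j)) *\<^sub>C (\<rho> f ^^ j) w = 0"
    using ef_eig[of j] j(2) by (simp add: zero)
  then have "of_nat (Suc j) * (m - of_nat j) = 0" using j(1) by simp
  then have "m = of_nat j" by (simp del: of_nat_Suc)
  then have "a = of_nat j - of_nat k * 2" by (simp add: m_def algebra_simps)
  then show ?thesis by simp
qed

lemma root_vector_shifts_weight:
  assumes rep: "lie_representation \<rho>" and x: "x \<in> root_space h \<alpha>" and v: "v \<in> weight_space h \<rho> \<nu>"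
  shows "\<rho> x v \<in> weight_space h \<rho> (\<lambda>y. \<alpha> y + \<nu> y)"
  unfolding weight_space_def
proof (intro CollectI ballI)
  fix y assume y: "y \<in> h"
  have "\<rho> y (\<rho> x v) = \<rho> (lie_bracket y x) v + \<rho> x (\<rho> y v)"
    using rep by (simp add: lie_representation_def)
  also have "\<dots> = (\<alpha> y + \<nu> y) *\<^sub>C \<rho> x v"
    using x v y rep by (simp add: weight_space_def lie_representation_def scaleC_add_left)
  finally show "\<rho> y (\<rho> x v) = (\<alpha> y + \<nu> y) *\<^sub>C \<rho> x v" .
qed

text \<open>
  Root vectors map weight vectors to weight vectors, and the root spaces span the Lie algebra
  because \<open>h\<close> is toral. Hence the span of the weight vectors is a subrepresentation, and by
  irreducibility a single nonzero weight vector suffices to make it everything.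
\<close>

lemma weight_vectors_span:
  fixes \<rho> :: "'g::lie_algebra \<Rightarrow> 'v::complex_vector \<Rightarrow> 'v"
  assumes irr: "irreducible_rep \<rho>" and toral: "toral h"
    and v: "lam \<in> dual_space h" "v \<in> weight_space h \<rho> lam" "v \<noteq> 0"
  shows "complex_vector.span (\<Union>\<nu>\<in>dual_space h. weight_space h \<rho> \<nu>) = UNIV" (is "complex_vector.span ?W = UNIV")
proof -
  have rep: "lie_representation \<rho>" using irr by (simp add: irreducible_rep_def)
  have R: "\<rho> x (v + w) = \<rho> x v + \<rho> x w" "\<rho> x (k *\<^sub>C v) = k *\<^sub>C \<rho> x v"
    "\<rho> (x + y) v = \<rho> x v + \<rho> y v" "\<rho> (k *\<^sub>C x) v = k *\<^sub>C \<rho> x v" for x y v w k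
    using rep by (simp_all add: lie_representation_def)
  have zero: "\<rho> x 0 = 0" for x using R(1)[of x 0 0] by simp
  have zero': "\<rho> 0 u = 0" for u using R(3)[of 0 0 u] by simp
  have W: "\<rho> x u \<in> complex_vector.span ?W" if u: "u \<in> ?W" for x u
  proof -
    have "x \<in> complex_vector.span (\<Union>\<alpha>\<in>dual_space h. root_space h \<alpha>)"
      using toral by (simp add: toral_def)
    then show ?thesis
    proof (induction rule: complex_vector.span_induct_alt)
      case base
      then show ?case by (simp add: zero' complex_vector.span_zero)
    next
      case (step c x y)
      then obtain \<alpha> where \<alpha>: "\<alpha> \<in> dual_space h" "x \<in> root_space h \<alpha>" by blast
      from u obtain \<nu> where \<nu>: "\<nu> \<in> dual_space h" "u \<in> weight_space h \<rho> \<nu>" by blast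
      have "(\<lambda>y. \<alpha> y + \<nu> y) \<in> dual_space h"
        using \<alpha>(1) \<nu>(1) by (auto simp: dual_space_def algebra_simps)
      then have "\<rho> x u \<in> complex_vector.span ?W"
        using root_vector_shifts_weight[OF rep \<alpha>(2) \<nu>(2)] by (blast intro: complex_vector.span_base)
      then show ?case using step
        by (simp add: R complex_vector.span_add complex_vector.span_scale)
    qed
  qed
  have "\<rho> x u \<in> complex_vector.span ?W" if "u \<in> complex_vector.span ?W" for x u
    using that
  proof (induction rule: complex_vector.span_induct_alt)
    case base
    then show ?case by (simp add: zero complex_vector.span_zero)
  next
    case (step c w y)
    then show ?case using W[OF step(1)]
      by (simp only: R complex_vector.span_add complex_vector.span_scale)
  qed
  moreover have "complex_vector.span ?W \<noteq> {0}"
    using v complex_vector.span_base[of v ?W] by blast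
  ultimately show ?thesis
    using irr complex_vector.subspace_span[of ?W] unfolding irreducible_rep_def by blast
qed

lemma dual_space_sum:
  assumes "\<nu> \<in> dual_space h" "complex_vector.subspace h" "\<And>i. i \<in> S \<Longrightarrow> c i \<in> h" "finite S"
  shows "\<nu> (\<Sum>i\<in>S. a i *\<^sub>C c i) = (\<Sum>i\<in>S. a i * \<nu> (c i))"
proof -
  have z: "\<nu> 0 = 0"
  proof -
    have "0 \<in> h" using assms(2) by (rule complex_vector.subspace_0)
    then have "\<nu> (0 *\<^sub>C 0) = 0 * \<nu> 0" using assms(1) unfolding dual_space_def by blast
    then show ?thesis by simp
  qed
  show ?thesis
    using assms(4,3)
  proof (induction S rule: finite_induct)
    case (insert i S)
    have "(\<Sum>i\<in>S. a i *\<^sub>C c i) \<in> h" "a i *\<^sub>C c i \<in> h"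
      using insert assms(2) by (auto intro!: complex_vector.subspace_sum complex_vector.subspace_scale)
    then show ?case using insert assms(1) by (simp add: dual_space_def)
  qed (simp add: z)
qed

lemma dual_space_sum_mset:
  "(\<And>e. e \<in># M \<Longrightarrow> wt e \<in> dual_space h) \<Longrightarrow> (\<lambda>x. \<Sum>e\<in>#M. wt e x) \<in> dual_space h"
  by (induction M) (auto simp: dual_space_def algebra_simps)

lemma weight_lattice_subset_dual_space:
  assumes "fundamental_weights h r c \<omega>"
  shows "weight_lattice r \<omega> \<subseteq> dual_space h"
  using assms
  by (auto simp: weight_lattice_def fundamental_weights_def dual_space_def sum.distrib sum_distrib_left algebra_simps
    intro!: sum.neutral)

lemma dominant_weights_subset_weight_lattice:
  fixes \<omega> :: "nat \<Rightarrow> 'g \<Rightarrow> complex"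
  shows "dominant_weights r \<omega> \<subseteq> weight_lattice r \<omega>"
proof
  fix \<nu> :: "'g \<Rightarrow> complex" assume "\<nu> \<in> dominant_weights r \<omega>"
  then obtain n :: "nat \<Rightarrow> nat" where "\<nu> = (\<lambda>x. \<Sum>i<r. of_nat (n i) * \<omega> i x)"
    by (auto simp: dominant_weights_def)
  then have "\<nu> = (\<lambda>x. \<Sum>i<r. of_int (int (n i)) * \<omega> i x)" by simp
  then show "\<nu> \<in> weight_lattice r \<omega>"
    unfolding weight_lattice_def by (intro CollectI exI[of _ "\<lambda>i. int (n i)"]) simp
qed

lemma weight_lattice_integral:
  assumes "fundamental_weights h r c \<omega>" "\<nu> \<in> weight_lattice r \<omega>" "i < r"
  shows "\<nu> (c i) \<in> \<int>"
  using assms by (auto simp: weight_lattice_def fundamental_weights_def)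

text \<open>
  The fundamental weights are dual to the \<open>c i\<close> and so make them linearly independent; being as
  many as the dimension of \<open>h\<close>, they form a basis. Hence a functional on \<open>h\<close> is determined by its
  values on the coroots, which are its coordinates with respect to the fundamental weights.
\<close>

lemma coroots_span_cartan:
  fixes h :: "'g::complex_vector set"
  assumes fin: "finite_dim (UNIV :: 'g set)" and h: "complex_vector.subspace h"
    and dim: "complex_vector.dim h = r" and fw: "fundamental_weights h r c \<omega>"
    and c: "\<And>i. i < r \<Longrightarrow> c i \<in> h" and x: "x \<in> h"
  shows "\<exists>t. x = (\<Sum>i<r. t i *\<^sub>C c i)"
proof -
  have om: "\<omega> i (c j) = (if i = j then 1 else 0)" "\<omega> i \<in> dual_space h" if "i < r" "j < r" for i j
    using fw that by (auto simp: fundamental_weights_def)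
  have inj: "inj_on c {..<r}"
  proof (rule inj_onI)
    fix i j assume "i \<in> {..<r}" "j \<in> {..<r}" "c i = c j"
    then show "i = j" using om(1)[of i i] om(1)[of i j] by (auto split: if_splits)
  qed
  have ind: "complex_vector.independent (c ` {..<r})"
  proof (rule complex_vector.independent_if_scalars_zero)
    fix f x assume z: "(\<Sum>x\<in>c ` {..<r}. f x *\<^sub>C x) = 0" and "x \<in> c ` {..<r}"
    then obtain i where i: "i < r" "x = c i" by auto
    have "(\<Sum>j<r. f (c j) *\<^sub>C c j) = 0" using z by (simp add: sum.reindex[OF inj])
    then have "\<omega> i (\<Sum>j<r. f (c j) *\<^sub>C c j) = \<omega> i (\<Sum>j\<in>{}. f (c j) *\<^sub>C c j)" by simp
    then have "(\<Sum>j<r. f (c j) * \<omega> i (c j)) = 0"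
      using om(2)[OF i(1) i(1)] h c by (subst (asm) (1 2) dual_space_sum) auto
    then show "f x = 0" using i by (simp add: om if_distrib cong: if_cong)
  qed simp
  obtain C where C: "C \<subseteq> h" "complex_vector.independent C" "h \<subseteq> complex_vector.span C" "card C = r"
    using complex_vector.basis_exists[of h] dim by metis
  have "finite C"
    using fin C(2) complex_vector.independent_span_bound[of _ C] unfolding finite_dim_def by auto
  have "x \<in> complex_vector.span (c ` {..<r})"
  proof (rule ccontr)
    assume n: "x \<notin> complex_vector.span (c ` {..<r})"
    then have "complex_vector.independent (insert x (c ` {..<r}))"
      using ind by (simp add: complex_vector.independent_insertI)
    moreover have "insert x (c ` {..<r}) \<subseteq> complex_vector.span C" using x c C by auto
    ultimately have "card (insert x (c ` {..<r})) \<le> card C"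
      using complex_vector.independent_span_bound[OF \<open>finite C\<close>] by blast
    moreover have "x \<notin> c ` {..<r}"
      using n complex_vector.span_superset[of "c ` {..<r}"] by blast
    ultimately show False using C(4) by (simp add: card_image[OF inj])
  qed
  then obtain u where "x = (\<Sum>v\<in>c ` {..<r}. u v *\<^sub>C v)"
    by (auto simp: complex_vector.span_finite)
  then show ?thesis by (auto simp: sum.reindex[OF inj])
qed

lemma dual_space_eqI:
  assumes "\<nu> \<in> dual_space h" "\<nu>' \<in> dual_space h" "\<And>x. x \<in> h \<Longrightarrow> \<nu> x = \<nu>' x"
  shows "\<nu> = \<nu>'"
proof
  fix x show "\<nu> x = \<nu>' x" using assms by (cases "x \<in> h") (auto simp: dual_space_def)
qed

lemma dual_space_eq_if_eq_on_coroots: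
  fixes h :: "'g::complex_vector set"
  assumes fin: "finite_dim (UNIV :: 'g set)" and h: "complex_vector.subspace h"
    and dim: "complex_vector.dim h = r" and fw: "fundamental_weights h r c \<omega>"
    and c: "\<And>i. i < r \<Longrightarrow> c i \<in> h"
    and \<nu>: "\<nu> \<in> dual_space h" "\<nu>' \<in> dual_space h" and eq: "\<And>i. i < r \<Longrightarrow> \<nu> (c i) = \<nu>' (c i)"
  shows "\<nu> = \<nu>'"
proof (rule dual_space_eqI[OF \<nu>])
  fix x assume "x \<in> h"
  then obtain t where "x = (\<Sum>i<r. t i *\<^sub>C c i)" using coroots_span_cartan[OF fin h dim fw c] by blast
  then show "\<nu> x = \<nu>' x"
    using dual_space_sum[OF \<nu>(1) h, of "{..<r}" c t] dual_space_sum[OF \<nu>(2) h, of "{..<r}" c t] c eq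
    by simp
qed

lemma integral_on_coroots_imp_weight_lattice:
  fixes h :: "'g::complex_vector set"
  assumes fin: "finite_dim (UNIV :: 'g set)" and h: "complex_vector.subspace h"
    and dim: "complex_vector.dim h = r" and fw: "fundamental_weights h r c \<omega>"
    and c: "\<And>i. i < r \<Longrightarrow> c i \<in> h"
    and \<nu>: "\<nu> \<in> dual_space h" "\<And>i. i < r \<Longrightarrow> \<nu> (c i) \<in> \<int>"
  shows "\<nu> \<in> weight_lattice r \<omega>"
proof -
  define n where "n i = \<lfloor>Re (\<nu> (c i))\<rfloor>" for i
  have n: "of_int (n i) = \<nu> (c i)" if "i < r" for i
    using \<nu>(2)[OF that] by (auto simp: n_def elim!: Ints_cases)
  define \<nu>' where "\<nu>' = (\<lambda>x. \<Sum>i<r. of_int (n i) * \<omega> i x)"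
  have \<nu>': "\<nu>' \<in> weight_lattice r \<omega>" by (auto simp: \<nu>'_def weight_lattice_def)
  have d': "\<nu>' \<in> dual_space h" using weight_lattice_subset_dual_space[OF fw] \<nu>' by blast
  have eq: "\<nu> (c j) = \<nu>' (c j)" if "j < r" for j
  proof -
    have "\<nu>' (c j) = (\<Sum>i<r. if i = j then \<nu> (c j) else 0)"
      unfolding \<nu>'_def using fw that n by (intro sum.cong) (auto simp: fundamental_weights_def)
    then show ?thesis using that by simp
  qed
  have "\<nu> = \<nu>'" by (rule dual_space_eq_if_eq_on_coroots[OF fin h dim fw c \<nu>(1) d' eq])
  then show ?thesis using \<nu>' by simp
qed

lemma coroot_acts_integrally:
  fixes \<rho> :: "'g::lie_algebra \<Rightarrow> 'v::complex_vector \<Rightarrow> 'v"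
  assumes rep: "lie_representation \<rho>" and fin: "finite_dim (UNIV :: 'v set)"
    and c: "is_coroot h \<alpha> c" and v: "v \<in> weight_space h \<rho> \<nu>" "v \<noteq> 0"
  shows "\<nu> c \<in> \<int>"
proof -
  obtain e f where "e \<in> root_space h \<alpha>" "f \<in> root_space h (\<lambda>x. - \<alpha> x)" "lie_bracket e f = c"
    "c \<in> h" "\<alpha> c = 2" using c by (auto simp: is_coroot_def)
  then show ?thesis
    using sl2_integral_eigenvalue[OF rep fin, of c e f v "\<nu> c"] v by (auto simp: weight_space_def)
qed

text \<open>
  A basis can be chosen among the weight vectors since they span, and their weights lie in the
  lattice because they take integral values on the coroots.
\<close>

lemma weight_basis_exists:
  fixes h :: "'g::lie_algebra set" and \<rho> :: "'g \<Rightarrow> 'v::complex_vector \<Rightarrow> 'v"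
  assumes fing: "finite_dim (UNIV :: 'g set)" and toral: "toral h"
    and dim: "complex_vector.dim h = r" and fw: "fundamental_weights h r c \<omega>"
    and c: "\<And>i. i < r \<Longrightarrow> is_coroot h (\<alpha> i) (c i)"
    and fin: "finite_dim (UNIV :: 'v set)" and irr: "irreducible_rep \<rho>"
    and v: "lam \<in> dual_space h" "v \<in> weight_space h \<rho> lam" "v \<noteq> 0"
  obtains E wt where "finite E" "complex_vector.independent E" "complex_vector.span E = UNIV"
    "\<And>e. e \<in> E \<Longrightarrow> wt e \<in> weight_lattice r \<omega>" "\<And>e. e \<in> E \<Longrightarrow> e \<in> weight_space h \<rho> (wt e)"
proof -
  let ?W = "\<Union>\<nu>\<in>dual_space h. weight_space h \<rho> \<nu>"
  have rep: "lie_representation \<rho>" using irr by (simp add: irreducible_rep_def)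
  have h: "complex_vector.subspace h" using toral by (simp add: toral_def)
  obtain E where E: "E \<subseteq> ?W" "complex_vector.independent E" "?W \<subseteq> complex_vector.span E"
    using complex_vector.maximal_independent_subset by blast
  have span: "complex_vector.span E = UNIV"
    using weight_vectors_span[OF irr toral v]
      complex_vector.span_minimal[OF E(3) complex_vector.subspace_span] by blast
  have finE: "finite E"
    using fin E(2) complex_vector.independent_span_bound[of _ E] unfolding finite_dim_def by auto
  have "\<forall>e\<in>E. \<exists>\<nu>. \<nu> \<in> dual_space h \<and> e \<in> weight_space h \<rho> \<nu>" using E(1) by blast
  then obtain wt where wt: "\<And>e. e \<in> E \<Longrightarrow> wt e \<in> dual_space h \<and> e \<in> weight_space h \<rho> (wt e)"
    by metis
  have "wt e \<in> weight_lattice r \<omega>" if e: "e \<in> E" for e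
  proof (rule integral_on_coroots_imp_weight_lattice[OF fing h dim fw])
    have "e \<noteq> 0" using e E(2) complex_vector.dependent_zero by blast
    then show "wt e (c i) \<in> \<int>" if "i < r" for i
      using coroot_acts_integrally[OF rep fin c[OF that]] wt[OF e] by blast
  qed (use wt e c in \<open>auto simp: is_coroot_def\<close>)
  then show ?thesis using that[OF finE E(2) span] wt by blast
qed


section \<open>Monomial bases of symmetric powers\<close>

text \<open>
  Finitely supported functions on multisets form a commutative ring under convolution, namely the
  polynomial ring with one variable \<open>sym_monomial {#v#}\<close> for each vector \<open>v\<close>; the formal product
  \<open>sym_monomial M\<close> is a monomial in this ring. The relations are the homogeneous parts of the
  ideal generated by the linear relations between the variables, and \<open>sym_action\<close> is a derivation.
\<close>

lemma scaleC_mult_left: "(c *\<^sub>C p) * q = c *\<^sub>C (p * q)"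
  and scaleC_mult_right: "p * (c *\<^sub>C q) = c *\<^sub>C (p * q)"
  for p q :: "'v multiset \<Rightarrow>\<^sub>0 complex"
proof -
  have "c *\<^sub>C p = Poly_Mapping.single 0 c * p" for p :: "'v multiset \<Rightarrow>\<^sub>0 complex"
    by (simp add: scaleC_poly_mapping_def scaleC_complex_def[abs_def] flip: mult_map_scale_conv_mult)
  then show "(c *\<^sub>C p) * q = c *\<^sub>C (p * q)" "p * (c *\<^sub>C q) = c *\<^sub>C (p * q)"
    by (simp_all add: mult_ac)
qed

lemma sym_monomial_empty: "sym_monomial {#} = 1"
  by (simp add: sym_monomial_def flip: single_one)

lemma sym_monomial_add_mset: "sym_monomial (add_mset v M) = sym_monomial {#v#} * sym_monomial M"
  by (simp add: sym_monomial_def mult_single)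

lemma lookup_sym_monomial: "Poly_Mapping.lookup (sym_monomial M) M' = (if M = M' then 1 else 0)"
  by (simp add: sym_monomial_def lookup_single)

lemma inj_sym_monomial: "inj sym_monomial"
  by (rule injI) (metis lookup_sym_monomial zero_neq_one)

definition linear_extension :: "('v multiset \<Rightarrow> 'w::complex_vector) \<Rightarrow> ('v multiset \<Rightarrow>\<^sub>0 complex) \<Rightarrow> 'w"
  where "linear_extension f p =
    (\<Sum>M\<in>Poly_Mapping.keys p. Poly_Mapping.lookup p M *\<^sub>C f M)"

lemma linear_extension_superset:
  assumes "finite S" "Poly_Mapping.keys p \<subseteq> S"
  shows "linear_extension f p = (\<Sum>M\<in>S. Poly_Mapping.lookup p M *\<^sub>C f M)"
  unfolding linear_extension_def
  using assms by (intro sum.mono_neutral_left) (auto simp: in_keys_iff)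

text \<open>
  Both the Lie algebra action on formal products and the substitution of coordinates below are
  linear extensions from monomials; this provides their linearity once and for all.
\<close>

interpretation linear_extension: module_hom
  "scaleC :: complex \<Rightarrow> ('v multiset \<Rightarrow>\<^sub>0 complex) \<Rightarrow> _" "scaleC :: complex \<Rightarrow> 'w::complex_vector \<Rightarrow> _"
  "linear_extension f"
proof unfold_locales
  fix p q :: "'v multiset \<Rightarrow>\<^sub>0 complex" and c :: complex
  let ?S = "Poly_Mapping.keys p \<union> Poly_Mapping.keys q"
  show "linear_extension f (p + q) = linear_extension f p + linear_extension f q"
    using keys_add[of p q]
    by (simp add: linear_extension_superset[where S = ?S] lookup_add scaleC_add_left sum.distrib)
  have "Poly_Mapping.keys (c *\<^sub>C p) \<subseteq> Poly_Mapping.keys p"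
    by (auto simp: in_keys_iff lookup_scaleC scaleC_complex_def)
  then show "linear_extension f (c *\<^sub>C p) = c *\<^sub>C linear_extension f p"
    by (simp add: linear_extension_superset[where S = "Poly_Mapping.keys p"] lookup_scaleC
        scaleC_complex_def complex_vector.scale_sum_right)
qed

lemma linear_extension_monomial: "linear_extension f (sym_monomial M) = f M"
  by (simp add: linear_extension_superset[where S = "{M}"] sym_monomial_def)

lemma sym_action_eq_linear_extension:
  "sym_action \<rho> x = linear_extension (\<lambda>M. \<Sum>v\<in>#M. sym_monomial (add_mset (\<rho> x v) (M - {#v#})))"
  by (simp add: fun_eq_iff sym_action_def linear_extension_def)

lemma sym_action_monomial:
  "sym_action \<rho> x (sym_monomial M) = (\<Sum>v\<in>#M. sym_monomial (add_mset (\<rho> x v) (M - {#v#})))"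
  by (simp add: sym_action_eq_linear_extension linear_extension_monomial)

text \<open>
  The Leibniz rule, for a product one of whose factors is a variable.
\<close>

lemma sym_action_add_mset:
  "sym_action \<rho> x (sym_monomial (add_mset v M)) =
    sym_monomial (add_mset (\<rho> x v) M) + sym_monomial {#v#} * sym_action \<rho> x (sym_monomial M)"
proof -
  have "(\<Sum>w\<in>#M. sym_monomial (add_mset (\<rho> x w) (add_mset v M - {#w#}))) =
      (\<Sum>w\<in>#M. sym_monomial {#v#} * sym_monomial (add_mset (\<rho> x w) (M - {#w#})))"
  proof (rule arg_cong[where f = sum_mset], rule image_mset_cong)
    fix w assume "w \<in># M"
    then have "add_mset (\<rho> x w) (add_mset v M - {#w#}) = add_mset v (add_mset (\<rho> x w) (M - {#w#}))"
      by (cases "v = w") (auto simp: add_mset_commute)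
    then show "sym_monomial (add_mset (\<rho> x w) (add_mset v M - {#w#})) =
        sym_monomial {#v#} * sym_monomial (add_mset (\<rho> x w) (M - {#w#}))"
      by (simp only: sym_monomial_add_mset[of v "add_mset (\<rho> x w) (M - {#w#})"])
  qed
  then show ?thesis
    by (simp add: sym_action_monomial sum_mset_distrib_left)
qed

lemma subspace_sym_rel: "complex_vector.subspace (sym_rel N)"
  by (simp add: sym_rel_def)

lemma sym_rel_add: "sym_monomial (add_mset (u + v) M) - sym_monomial (add_mset u M)
    - sym_monomial (add_mset v M) \<in> sym_rel (Suc (size M))"
  unfolding sym_rel_def by (rule complex_vector.span_base) blast

lemma sym_rel_scale: "sym_monomial (add_mset (c *\<^sub>C u) M) - c *\<^sub>C sym_monomial (add_mset u M)
    \<in> sym_rel (Suc (size M))"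
  unfolding sym_rel_def by (rule complex_vector.span_base) blast

lemma sym_rel_subset:
  assumes "complex_vector.subspace W"
    and "\<And>u v M. Suc (size M) = N \<Longrightarrow> sym_monomial (add_mset (u + v) M) - sym_monomial (add_mset u M)
      - sym_monomial (add_mset v M) \<in> W"
    and "\<And>c u M. Suc (size M) = N \<Longrightarrow>
      sym_monomial (add_mset (c *\<^sub>C u) M) - c *\<^sub>C sym_monomial (add_mset u M) \<in> W"
  shows "sym_rel N \<subseteq> W"
  unfolding sym_rel_def using assms by (intro complex_vector.span_minimal) auto

lemma subspace_times_preimage:
  fixes W :: "('v multiset \<Rightarrow>\<^sub>0 complex) set"
  assumes "complex_vector.subspace W"
  shows "complex_vector.subspace {p. q * p \<in> W}"
  using assms
  by (auto simp: complex_vector.subspace_def distrib_left scaleC_mult_right)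

lemma monomial_times_sym_rel:
  assumes "p \<in> sym_rel N"
  shows "sym_monomial {#v#} * p \<in> sym_rel (Suc N)"
proof -
  have "sym_rel N \<subseteq> {p. sym_monomial {#v#} * p \<in> sym_rel (Suc N)}"
  proof (rule sym_rel_subset[OF subspace_times_preimage[OF subspace_sym_rel]])
    fix u w :: 'a and c and M :: "'a multiset" assume M: "Suc (size M) = N"
    have eq: "sym_monomial {#v#} * sym_monomial (add_mset u M) = sym_monomial (add_mset u (add_mset v M))"
      for u by (simp add: sym_monomial_add_mset[of v, symmetric] add_mset_commute)
    show "sym_monomial (add_mset (u + w) M) - sym_monomial (add_mset u M) - sym_monomial (add_mset w M)
        \<in> {p. sym_monomial {#v#} * p \<in> sym_rel (Suc N)}"
      using sym_rel_add[of u w "add_mset v M"] M by (simp add: right_diff_distrib eq)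
    show "sym_monomial (add_mset (c *\<^sub>C u) M) - c *\<^sub>C sym_monomial (add_mset u M)
        \<in> {p. sym_monomial {#v#} * p \<in> sym_rel (Suc N)}"
      using sym_rel_scale[of c u "add_mset v M"] M by (simp add: right_diff_distrib eq scaleC_mult_right)
  qed
  then show ?thesis using assms by blast
qed

text \<open>
  The multilinear relations allow a factor that is a linear combination to be replaced by the same
  combination of variables.
\<close>

lemma sym_rel_sum:
  assumes "finite S"
  shows "(sym_monomial {#\<Sum>e\<in>S. c e *\<^sub>C e#} - (\<Sum>e\<in>S. c e *\<^sub>C sym_monomial {#e#})) * sym_monomial M
    \<in> sym_rel (Suc (size M))"
  using assms
proof (induction S rule: finite_induct)
  case empty
  show ?case using sym_rel_scale[of 0 0 M] by (simp add: sym_monomial_add_mset[of _ M])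
next
  case (insert e S)
  let ?s = "\<Sum>e\<in>S. c e *\<^sub>C e" and ?t = "\<Sum>e\<in>S. c e *\<^sub>C sym_monomial {#e#}"
  let ?m = "\<lambda>v. sym_monomial {#v#}" and ?R = "sym_rel (Suc (size M))"
  have 1: "(?m (c e *\<^sub>C e + ?s) - ?m (c e *\<^sub>C e) - ?m ?s) * sym_monomial M \<in> ?R"
    using sym_rel_add[of "c e *\<^sub>C e" ?s M] by (simp add: sym_monomial_add_mset[of _ M] left_diff_distrib)
  have 2: "(?m (c e *\<^sub>C e) - c e *\<^sub>C ?m e) * sym_monomial M \<in> ?R"
    using sym_rel_scale[of "c e" e M]
    by (simp add: sym_monomial_add_mset[of _ M] left_diff_distrib scaleC_mult_left)
  have "(?m (c e *\<^sub>C e + ?s) - (c e *\<^sub>C ?m e + ?t)) * sym_monomial M =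
      (?m (c e *\<^sub>C e + ?s) - ?m (c e *\<^sub>C e) - ?m ?s) * sym_monomial M
      + (?m (c e *\<^sub>C e) - c e *\<^sub>C ?m e) * sym_monomial M + (?m ?s - ?t) * sym_monomial M"
    by (simp add: left_diff_distrib distrib_right)
  then show ?case
    using 1 2 insert by (simp add: complex_vector.subspace_add[OF subspace_sym_rel])
qed

text \<open>
  The action descends to the quotient. On a generator of the relations, of the form \<open>q m\<close> with
  a linear relation \<open>q\<close> and a monomial \<open>m\<close>, the Leibniz rule gives a relation of the same type
  for the vectors \<open>\<rho> x u\<close>, multiplied by \<open>m\<close>, and in addition \<open>q\<close> times a sum of monomials of the
  same degree as \<open>m\<close>.
\<close>

lemma sym_action_sym_rel:
  assumes rep: "lie_representation \<rho>" and p: "p \<in> sym_rel N"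
  shows "sym_action \<rho> x p \<in> sym_rel N"
proof -
  let ?D = "sym_action \<rho> x"
  have lin: "?D (p + q) = ?D p + ?D q" "?D (c *\<^sub>C p) = c *\<^sub>C ?D p" "?D (p - q) = ?D p - ?D q" for p q c
    by (simp_all add: sym_action_eq_linear_extension linear_extension.add linear_extension.scale
        linear_extension.diff)
  have R: "\<rho> x (v + w) = \<rho> x v + \<rho> x w" "\<rho> x (k *\<^sub>C v) = k *\<^sub>C \<rho> x v" for v w k
    using rep by (simp_all add: lie_representation_def)
  have sub: "complex_vector.subspace {p. ?D p \<in> sym_rel N}"
    using subspace_sym_rel[of N] unfolding sym_action_eq_linear_extension
    by (rule linear_extension.subspace_linear_preimage)
  have times: "(\<And>M'. size M' = size M \<Longrightarrow> q * sym_monomial M' \<in> sym_rel N) \<Longrightarrow> q * ?D (sym_monomial M) \<in> sym_rel N"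
    for q M
  proof -
    assume a: "\<And>M'. size M' = size M \<Longrightarrow> q * sym_monomial M' \<in> sym_rel N"
    have "q * (\<Sum>v\<in>#K. sym_monomial (add_mset (\<rho> x v) (M - {#v#}))) \<in> sym_rel N" if "K \<subseteq># M" for K
      using that
    proof (induction K)
      case empty
      then show ?case by (simp add: complex_vector.subspace_0[OF subspace_sym_rel])
    next
      case (add v K)
      then have "v \<in># M" "K \<subseteq># M"
        by (meson mset_subset_eqD union_single_eq_member, meson mset_subset_eq_insertD subset_mset.less_imp_le)
      moreover from this have "size (add_mset (\<rho> x v) (M - {#v#})) = size M"
        by (metis insert_DiffM size_add_mset)
      ultimately show ?case
        using add a by (simp add: distrib_left complex_vector.subspace_add[OF subspace_sym_rel])
    qed
    then show ?thesis by (simp add: sym_action_monomial)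
  qed
  have "sym_rel N \<subseteq> {p. ?D p \<in> sym_rel N}"
  proof (rule sym_rel_subset[OF sub])
    fix u w :: 'b and c and M :: "'b multiset" assume M: "Suc (size M) = N"
    let ?m = "\<lambda>v. sym_monomial {#v#}"
    have "(?m (u + w) - ?m u - ?m w) * ?D (sym_monomial M) \<in> sym_rel N"
    proof (rule times)
      fix M' :: "'b multiset" assume "size M' = size M"
      then show "(?m (u + w) - ?m u - ?m w) * sym_monomial M' \<in> sym_rel N"
        using sym_rel_add[of u w M'] M by (simp add: sym_monomial_add_mset[of _ M'] left_diff_distrib)
    qed
    moreover have "?D (sym_monomial (add_mset (u + w) M) - sym_monomial (add_mset u M) - sym_monomial (add_mset w M))
      = (sym_monomial (add_mset (\<rho> x u + \<rho> x w) M) - sym_monomial (add_mset (\<rho> x u) M) - sym_monomial (add_mset (\<rho> x w) M))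
        + (?m (u + w) - ?m u - ?m w) * ?D (sym_monomial M)"
      by (simp add: lin sym_action_add_mset R left_diff_distrib)
    ultimately show "sym_monomial (add_mset (u + w) M) - sym_monomial (add_mset u M) - sym_monomial (add_mset w M)
        \<in> {p. ?D p \<in> sym_rel N}"
      using sym_rel_add[of "\<rho> x u" "\<rho> x w" M] M by (simp add: complex_vector.subspace_add[OF subspace_sym_rel])
    have "(?m (c *\<^sub>C u) - c *\<^sub>C ?m u) * ?D (sym_monomial M) \<in> sym_rel N"
    proof (rule times)
      fix M' :: "'b multiset" assume "size M' = size M"
      then show "(?m (c *\<^sub>C u) - c *\<^sub>C ?m u) * sym_monomial M' \<in> sym_rel N"
        using sym_rel_scale[of c u M'] M
        by (simp add: sym_monomial_add_mset[of _ M'] left_diff_distrib scaleC_mult_left)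
    qed
    moreover have "?D (sym_monomial (add_mset (c *\<^sub>C u) M) - c *\<^sub>C sym_monomial (add_mset u M))
      = (sym_monomial (add_mset (c *\<^sub>C \<rho> x u) M) - c *\<^sub>C sym_monomial (add_mset (\<rho> x u) M))
        + (?m (c *\<^sub>C u) - c *\<^sub>C ?m u) * ?D (sym_monomial M)"
      by (simp add: lin sym_action_add_mset R left_diff_distrib scaleC_mult_left scaleC_add_right)
    ultimately show "sym_monomial (add_mset (c *\<^sub>C u) M) - c *\<^sub>C sym_monomial (add_mset u M)
        \<in> {p. ?D p \<in> sym_rel N}"
      using sym_rel_scale[of c "\<rho> x u" M] M by (simp add: complex_vector.subspace_add[OF subspace_sym_rel])
  qed
  then show ?thesis using p by blast
qed

definition coordinate_form :: "'v::complex_vector set \<Rightarrow> 'v \<Rightarrow> 'v multiset \<Rightarrow>\<^sub>0 complex"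
  where "coordinate_form E v = (\<Sum>e\<in>E. complex_vector.representation E v e *\<^sub>C sym_monomial {#e#})"

text \<open>
  The ring endomorphism that substitutes for each variable its expression in terms of the variables
  of the basis \<open>E\<close>. It is the normal form map of the symmetric power: it kills the relations,
  does not change an element modulo the relations, and fixes the monomials in basis vectors.
\<close>

definition coordinate_expansion :: "'v::complex_vector set \<Rightarrow> ('v multiset \<Rightarrow>\<^sub>0 complex) \<Rightarrow> 'v multiset \<Rightarrow>\<^sub>0 complex"
  where "coordinate_expansion E = linear_extension (\<lambda>M. \<Prod>v\<in>#M. coordinate_form E v)"

context
  fixes E :: "'v::complex_vector set"
  assumes finE: "finite E" and indE: "complex_vector.independent E"
    and spanE: "complex_vector.span E = UNIV"
begin

lemma coordinate_form_add: "coordinate_form E (u + v) = coordinate_form E u + coordinate_form E v"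
  by (simp add: coordinate_form_def complex_vector.representation_add[OF indE] spanE scaleC_add_left sum.distrib)

lemma coordinate_form_scale: "coordinate_form E (c *\<^sub>C u) = c *\<^sub>C coordinate_form E u"
  by (simp add: coordinate_form_def complex_vector.representation_scale[OF indE] spanE
      complex_vector.scale_sum_right)

lemma coordinate_form_basis: "e \<in> E \<Longrightarrow> coordinate_form E e = sym_monomial {#e#}"
  by (simp add: coordinate_form_def complex_vector.representation_basis[OF indE] finE
      if_distrib[of "\<lambda>c. c *\<^sub>C _"] cong: if_cong)

lemma coordinate_expansion_monomial: "coordinate_expansion E (sym_monomial M) = (\<Prod>v\<in>#M. coordinate_form E v)"
  by (simp add: coordinate_expansion_def linear_extension_monomial)

lemma coordinate_expansion_sum: "coordinate_expansion E (\<Sum>i\<in>I. f i) = (\<Sum>i\<in>I. coordinate_expansion E (f i))"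
  and coordinate_expansion_scale: "coordinate_expansion E (c *\<^sub>C p) = c *\<^sub>C coordinate_expansion E p"
  and coordinate_expansion_diff: "coordinate_expansion E (p - q) = coordinate_expansion E p - coordinate_expansion E q"
  by (simp_all add: coordinate_expansion_def linear_extension.sum linear_extension.scale linear_extension.diff)

lemma coordinate_expansion_basis_monomial:
  "M \<in> multisets_of_size E N \<Longrightarrow> coordinate_expansion E (sym_monomial M) = sym_monomial M"
  unfolding coordinate_expansion_monomial
proof (induction M arbitrary: N)
  case (add v M)
  then have "v \<in> E" "M \<in> multisets_of_size E (N - 1)" by (auto simp: multisets_of_size_def)
  then show ?case using add.IH by (simp add: coordinate_form_basis sym_monomial_add_mset[of v M])
qed (simp add: sym_monomial_empty)

lemma coordinate_expansion_sym_rel: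
  assumes "p \<in> sym_rel N"
  shows "coordinate_expansion E p = 0"
proof -
  have "sym_rel N \<subseteq> {p. coordinate_expansion E p = 0}"
  proof (rule sym_rel_subset)
    show "complex_vector.subspace {p. coordinate_expansion E p = 0}"
      unfolding coordinate_expansion_def by (rule linear_extension.subspace_kernel)
  qed (simp_all add: coordinate_expansion_diff coordinate_expansion_scale coordinate_expansion_monomial coordinate_form_add
      coordinate_form_scale distrib_right scaleC_mult_left)
  then show ?thesis using assms by blast
qed

text \<open>
  Telescoping: with \<open>P\<close> the coordinate form of \<open>v\<close>, the error for the product of \<open>v\<close> and \<open>M\<close>
  is \<open>(v - P) M\<close>, a consequence of linearity in one factor, plus \<open>P\<close> times the error for \<open>M\<close>.
\<close>

lemma monomial_minus_coordinate_expansion: "sym_monomial M - coordinate_expansion E (sym_monomial M) \<in> sym_rel (size M)"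
proof (induction M)
  case empty
  show ?case unfolding coordinate_expansion_monomial by (simp add: sym_monomial_empty complex_vector.subspace_0[OF subspace_sym_rel])
next
  case (add v M)
  let ?R = "sym_rel (Suc (size M))" and ?P = "coordinate_form E v"
  have v: "(\<Sum>e\<in>E. complex_vector.representation E v e *\<^sub>C e) = v"
    by (rule complex_vector.sum_representation_eq[OF indE _ finE]) (simp_all add: spanE)
  have 1: "(sym_monomial {#v#} - ?P) * sym_monomial M \<in> ?R"
    using sym_rel_sum[OF finE, of "complex_vector.representation E v" M]
    by (simp add: v flip: coordinate_form_def)
  have 2: "?P * (sym_monomial M - coordinate_expansion E (sym_monomial M)) \<in> ?R"
    unfolding coordinate_form_def sum_distrib_right scaleC_mult_left
    by (intro complex_vector.subspace_sum complex_vector.subspace_scale subspace_sym_rel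
        monomial_times_sym_rel add)
  have "sym_monomial (add_mset v M) - coordinate_expansion E (sym_monomial (add_mset v M)) =
      (sym_monomial {#v#} - ?P) * sym_monomial M + ?P * (sym_monomial M - coordinate_expansion E (sym_monomial M))"
  proof -
    have "coordinate_expansion E (sym_monomial (add_mset v M)) = ?P * coordinate_expansion E (sym_monomial M)"
      by (simp add: coordinate_expansion_monomial)
    then show ?thesis
      by (simp add: sym_monomial_add_mset[of v M] left_diff_distrib right_diff_distrib)
  qed
  then show ?case
    using complex_vector.subspace_add[OF subspace_sym_rel 1 2] by simp
qed

lemma coordinate_expansion_monomial_in_span:
  "coordinate_expansion E (sym_monomial M) \<in> complex_vector.span (sym_monomial ` multisets_of_size E (size M))"
proof (induction M)
  case empty
  show ?case unfolding coordinate_expansion_monomial by (simp add: sym_monomial_empty complex_vector.span_base)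
next
  case (add v M)
  let ?S = "\<lambda>N. complex_vector.span (sym_monomial ` multisets_of_size E N)"
  have times: "sym_monomial {#e#} * p \<in> ?S (Suc N)" if e: "e \<in> E" and p: "p \<in> ?S N" for e p N
  proof -
    have "?S N \<subseteq> {p. sym_monomial {#e#} * p \<in> ?S (Suc N)}"
    proof (rule complex_vector.span_minimal)
      show "sym_monomial ` multisets_of_size E N \<subseteq> {p. sym_monomial {#e#} * p \<in> ?S (Suc N)}"
        using e by (auto simp: multisets_of_size_def simp flip: sym_monomial_add_mset
            intro!: complex_vector.span_base)
    qed (rule subspace_times_preimage, rule complex_vector.subspace_span)
    then show ?thesis using p by blast
  qed
  have "coordinate_expansion E (sym_monomial (add_mset v M)) =
      (\<Sum>e\<in>E. complex_vector.representation E v e *\<^sub>C (sym_monomial {#e#} * coordinate_expansion E (sym_monomial M)))"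
    by (simp add: coordinate_expansion_monomial coordinate_form_def[of E v] sum_distrib_right scaleC_mult_left)
  then show ?case
    using times[OF _ add] by (simp add: complex_vector.span_sum complex_vector.span_scale)
qed

lemma sym_free_coordinate_expansion:
  assumes "p \<in> sym_free N"
  shows "p - coordinate_expansion E p \<in> sym_rel N"
    and "coordinate_expansion E p \<in> complex_vector.span (sym_monomial ` multisets_of_size E N)"
proof -
  have hom: "module_hom scaleC scaleC (\<lambda>p. p - coordinate_expansion E p)"
    unfolding coordinate_expansion_def
    by unfold_locales (simp_all add: linear_extension.add linear_extension.scale
        complex_vector.scale_right_diff_distrib)
  have "sym_free N \<subseteq> {p. p - coordinate_expansion E p \<in> sym_rel N}"
    unfolding sym_free_def
    using monomial_minus_coordinate_expansion
    by (intro complex_vector.span_minimal module_hom.subspace_linear_preimage[OF hom] subspace_sym_rel) auto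
  then show "p - coordinate_expansion E p \<in> sym_rel N" using assms by blast
  have "sym_free N \<subseteq> {p. coordinate_expansion E p \<in> complex_vector.span (sym_monomial ` multisets_of_size E N)}"
    unfolding sym_free_def
  proof (intro complex_vector.span_minimal)
    show "{sym_monomial M |M. size M = N} \<subseteq>
        {p. coordinate_expansion E p \<in> complex_vector.span (sym_monomial ` multisets_of_size E N)}"
      using coordinate_expansion_monomial_in_span by auto
    show "complex_vector.subspace {p. coordinate_expansion E p \<in> complex_vector.span (sym_monomial ` multisets_of_size E N)}"
      unfolding coordinate_expansion_def by (rule linear_extension.subspace_linear_preimage) simp
  qed
  then show "coordinate_expansion E p \<in> complex_vector.span (sym_monomial ` multisets_of_size E N)"
    using assms by blast
qed

lemma basis_monomials_independent_mod_sym_rel: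
  assumes "S \<subseteq> multisets_of_size E N" "finite S"
    and "(\<Sum>M\<in>S. c M *\<^sub>C sym_monomial M) \<in> sym_rel N" and "M \<in> S"
  shows "c M = 0"
proof -
  have "0 = coordinate_expansion E (\<Sum>M\<in>S. c M *\<^sub>C sym_monomial M)"
    using coordinate_expansion_sym_rel[OF assms(3)] by simp
  also have "\<dots> = (\<Sum>M\<in>S. c M *\<^sub>C sym_monomial M)"
    unfolding coordinate_expansion_sum coordinate_expansion_scale using assms(1) coordinate_expansion_basis_monomial
    by (intro sum.cong) auto
  finally have "Poly_Mapping.lookup (\<Sum>M\<in>S. c M *\<^sub>C sym_monomial M) M = 0" by simp
  then show ?thesis
    using assms(2,4)
    by (simp add: lookup_sum lookup_scaleC lookup_sym_monomial scaleC_complex_def if_distrib cong: if_cong)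
qed

lemma sym_action_weight_monomial:
  assumes wt: "\<And>e. e \<in> E \<Longrightarrow> e \<in> weight_space h \<rho> (wt e)"
    and M: "set_mset M \<subseteq> E" and x: "x \<in> h"
  shows "sym_action \<rho> x (sym_monomial M) - (\<Sum>e\<in>#M. wt e x) *\<^sub>C sym_monomial M \<in> sym_rel (size M)"
  using M
proof (induction M)
  case empty
  show ?case by (simp add: sym_action_monomial complex_vector.subspace_0[OF subspace_sym_rel])
next
  case (add e M)
  then have e: "\<rho> x e = wt e x *\<^sub>C e" using wt x by (simp add: weight_space_def)
  let ?s = "\<Sum>e\<in>#M. wt e x"
  have "sym_action \<rho> x (sym_monomial (add_mset e M)) - (wt e x + ?s) *\<^sub>C sym_monomial (add_mset e M) =
    (sym_monomial (add_mset (wt e x *\<^sub>C e) M) - wt e x *\<^sub>C sym_monomial (add_mset e M))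
    + sym_monomial {#e#} * (sym_action \<rho> x (sym_monomial M) - ?s *\<^sub>C sym_monomial M)"
    by (simp add: sym_action_add_mset e scaleC_add_left right_diff_distrib scaleC_mult_right
        flip: sym_monomial_add_mset)
  moreover have "\<dots> \<in> sym_rel (Suc (size M))"
    using add by (intro complex_vector.subspace_add[OF subspace_sym_rel] sym_rel_scale
        monomial_times_sym_rel) auto
  ultimately show ?case by simp
qed

text \<open>
  The monomials in a basis of weight vectors form a basis of the symmetric power, and each of them
  is a weight vector, whose weight is the sum of the weights of its factors. So the action of the
  Cartan subalgebra is diagonal in this basis, and a weight multiplicity counts the monomials of
  that weight.
\<close>

proposition weight_mult_eq_card:
  assumes rep: "lie_representation \<rho>"
    and wt: "\<And>e. e \<in> E \<Longrightarrow> e \<in> weight_space h \<rho> (wt e)" "\<And>e. e \<in> E \<Longrightarrow> wt e \<in> dual_space h"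
    and \<mu>: "\<mu> \<in> dual_space h"
  shows "weight_mult h \<rho> N \<mu> = card {M \<in> multisets_of_size E N. (\<lambda>x. \<Sum>e\<in>#M. wt e x) = \<mu>}"
    (is "_ = card ?S")
proof -
  let ?w = "\<lambda>M x. \<Sum>e\<in>#M. wt e x" and ?D = "sym_action \<rho>" and ?A = "multisets_of_size E N"
  let ?R = "sym_rel N :: ('v multiset \<Rightarrow>\<^sub>0 complex) set"
  have fin: "finite ?A" "finite ?S" using finite_multisets_of_size[OF finE, of N] by auto
  have inj: "inj_on sym_monomial X" for X :: "'v multiset set"
    using inj_sym_monomial inj_on_subset by blast
  have lin: "?D x (p - q) = ?D x p - ?D x q" "?D x (c *\<^sub>C p) = c *\<^sub>C ?D x p"
    "?D x (\<Sum>i\<in>I. f i) = (\<Sum>i\<in>I. ?D x (f i))" for x p q c I and f :: "'v multiset \<Rightarrow> _"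
    by (simp_all add: sym_action_eq_linear_extension linear_extension.sum linear_extension.scale
        linear_extension.diff)
  note sub = subspace_sym_rel[of N, where ?'a = 'v]
  have act: "?D x (sym_monomial M) - ?w M x *\<^sub>C sym_monomial M \<in> ?R" if "M \<in> ?A" "x \<in> h" for M x
    using sym_action_weight_monomial[of h \<rho> wt M x] wt that by (auto simp: multisets_of_size_def)
  have "quot_basis (sym_weight_space h \<rho> N \<mu>) ?R (sym_monomial ` ?S)"
    unfolding quot_basis_def
  proof (intro conjI allI impI)
    show "finite (sym_monomial ` ?S)" using fin by simp
    show "sym_monomial ` ?S \<subseteq> sym_weight_space h \<rho> N \<mu>"
    proof
      fix p assume "p \<in> sym_monomial ` ?S"
      then obtain M where M: "M \<in> ?A" "?w M = \<mu>" "p = sym_monomial M" by auto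
      then have "p \<in> sym_free N"
        unfolding sym_free_def by (intro complex_vector.span_base) (auto simp: multisets_of_size_def)
      moreover have "?D x p - \<mu> x *\<^sub>C p \<in> ?R" if "x \<in> h" for x
        using act[OF M(1) that] M(2,3) by auto
      ultimately show "p \<in> sym_weight_space h \<rho> N \<mu>" by (simp add: sym_weight_space_def)
    qed
    show "\<forall>b\<in>sym_monomial ` ?S. c b = 0" if "(\<Sum>b\<in>sym_monomial ` ?S. c b *\<^sub>C b) \<in> ?R" for c
    proof -
      have "(\<Sum>M\<in>?S. c (sym_monomial M) *\<^sub>C sym_monomial M) \<in> ?R"
        using that by (simp add: sum.reindex[OF inj])
      from basis_monomials_independent_mod_sym_rel[OF _ fin(2) this] show ?thesis by auto
    qed
    show "sym_weight_space h \<rho> N \<mu> \<subseteq> complex_vector.span (sym_monomial ` ?S \<union> ?R)"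
    proof
      fix p assume "p \<in> sym_weight_space h \<rho> N \<mu>"
      then have p: "p \<in> sym_free N" "\<And>x. x \<in> h \<Longrightarrow> ?D x p - \<mu> x *\<^sub>C p \<in> ?R"
        by (auto simp: sym_weight_space_def)
      \<comment> \<open>The normal form of \<open>p\<close> is a combination of basis monomials; comparing coefficients in the
        eigenvalue equation shows that only those of weight \<open>\<mu>\<close> can occur.\<close>
      define q where "q = coordinate_expansion E p"
      have pq: "p - q \<in> ?R" using sym_free_coordinate_expansion(1)[OF p(1)] by (simp add: q_def)
      have "q \<in> complex_vector.span (sym_monomial ` ?A)"
        using sym_free_coordinate_expansion(2)[OF p(1)] by (simp add: q_def)
      then obtain u where "q = (\<Sum>b\<in>sym_monomial ` ?A. u b *\<^sub>C b)"
        using fin by (auto simp: complex_vector.span_finite)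
      then obtain c where q: "q = (\<Sum>M\<in>?A. c M *\<^sub>C sym_monomial M)"
        by (simp add: sum.reindex[OF inj])
      have c0: "c M = 0" if M: "M \<in> ?A" "?w M \<noteq> \<mu>" for M
      proof -
        have "?w M \<in> dual_space h"
          using M wt by (intro dual_space_sum_mset) (auto simp: multisets_of_size_def)
        then obtain x where x: "x \<in> h" "?w M x \<noteq> \<mu> x"
          using M(2) \<mu> by (auto simp: dual_space_def fun_eq_iff) metis
        have 1: "?D x (p - q) - \<mu> x *\<^sub>C (p - q) \<in> ?R"
          by (rule complex_vector.subspace_diff[OF sub sym_action_sym_rel[OF rep pq]
                complex_vector.subspace_scale[OF sub pq]])
        have "(\<Sum>M\<in>?A. c M *\<^sub>C (?D x (sym_monomial M) - ?w M x *\<^sub>C sym_monomial M)) \<in> ?R" (is "?t \<in> _")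
          using act x by (intro complex_vector.subspace_sum complex_vector.subspace_scale sub)
        then have "(?D x p - \<mu> x *\<^sub>C p) - (?D x (p - q) - \<mu> x *\<^sub>C (p - q)) - ?t \<in> ?R"
          by (rule complex_vector.subspace_diff[OF sub
                complex_vector.subspace_diff[OF sub p(2)[OF x(1)] 1]])
        also have "(?D x p - \<mu> x *\<^sub>C p) - (?D x (p - q) - \<mu> x *\<^sub>C (p - q)) - ?t =
            (\<Sum>M\<in>?A. (c M * (?w M x - \<mu> x)) *\<^sub>C sym_monomial M)"
          by (simp add: lin complex_vector.scale_right_diff_distrib right_diff_distrib
              complex_vector.scale_left_diff_distrib sum_subtractf complex_vector.scale_sum_right q
              scaleC_scaleC mult.commute)
        finally have "c M * (?w M x - \<mu> x) = 0"
          by (rule basis_monomials_independent_mod_sym_rel[OF subset_refl fin(1) _ M(1)])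
        then show ?thesis using x by simp
      qed
      have "q = (\<Sum>M\<in>?S. c M *\<^sub>C sym_monomial M)"
        unfolding q using fin c0 by (intro sum.mono_neutral_right) auto
      then have "q \<in> complex_vector.span (sym_monomial ` ?S \<union> ?R)"
        by (simp only:) (intro complex_vector.span_sum complex_vector.span_scale complex_vector.span_base; blast)
      moreover have "p - q \<in> complex_vector.span (sym_monomial ` ?S \<union> ?R)"
        using pq by (auto intro!: complex_vector.span_base)
      ultimately have "q + (p - q) \<in> complex_vector.span (sym_monomial ` ?S \<union> ?R)"
        by (rule complex_vector.span_add)
      then show "p \<in> complex_vector.span (sym_monomial ` ?S \<union> ?R)" by simp
    qed
  qed
  from quot_dim_eq_card[OF sub this] show ?thesis
    by (simp add: weight_mult_def card_image[OF inj])
qed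

end


section \<open>Generating functions and Fourier coefficients\<close>

text \<open>
  The generating function of the complete homogeneous symmetric polynomials. Adding a variable to
  \<open>E\<close> multiplies the series by a geometric series, and in the Cauchy product the exponent of the
  new variable is its multiplicity in the multiset. The statement is proved for all \<open>z\<close> in the
  unit disc at once, since the absolute convergence that the Cauchy product requires at \<open>z\<close> comes from
  convergence at a point of larger modulus.
\<close>

lemma complete_homogeneous_sums:
  fixes y :: "'a \<Rightarrow> complex"
  assumes "finite E" and "\<And>e. e \<in> E \<Longrightarrow> norm (y e) \<le> 1" and "norm z < 1"
  shows "(\<lambda>N. z ^ N * (\<Sum>M\<in>multisets_of_size E N. \<Prod>e\<in>#M. y e)) sums (\<Prod>e\<in>E. 1 / (1 - y e * z))"
  using assms
proof (induction E arbitrary: z rule: finite_induct)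
  case empty
  have "(\<lambda>N. z ^ N * (\<Sum>M\<in>multisets_of_size {} N. \<Prod>e\<in>#M. y e)) = (\<lambda>N. if N = 0 then 1 else 0)"
    by (auto simp: fun_eq_iff)
  then show ?case using sums_single[of 0 "\<lambda>_. 1::complex"] by simp
next
  case (insert a E)
  define H where "H N = (\<Sum>M\<in>multisets_of_size E N. \<Prod>e\<in>#M. y e)" for N
  have IH: "(\<lambda>N. z ^ N * H N) sums (\<Prod>e\<in>E. 1 / (1 - y e * z))" if "norm z < 1" for z
    using insert that by (simp add: H_def)
  have "norm (y a * z) \<le> 1 * norm z"
    unfolding norm_mult using insert by (intro mult_right_mono) auto
  then have az: "norm (y a * z) < 1" using insert by simp
  obtain w where w: "norm z < w" "w < 1" using insert.prems dense by blast
  then have "summable (\<lambda>N. H N * of_real w ^ N)"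
    using IH[of "of_real w"] norm_ge_zero[of z] by (auto simp: sums_iff mult.commute)
  then have abs: "summable (\<lambda>N. norm (z ^ N * H N))"
    using powser_insidea[of H "of_real w" z] w norm_ge_zero[of z] by (simp add: mult.commute)
  have geo: "(\<lambda>k. (y a * z) ^ k) sums (1 / (1 - y a * z))" using geometric_sums[OF az] .
  have abs_geo: "summable (\<lambda>k. norm ((y a * z) ^ k))"
    using az by (simp add: norm_power summable_geometric)
  have "(\<Sum>i\<le>N. (y a * z) ^ i * (z ^ (N - i) * H (N - i))) =
      z ^ N * (\<Sum>M\<in>multisets_of_size (insert a E) N. \<Prod>e\<in>#M. y e)" for N
  proof -
    have "(\<Sum>M\<in>multisets_of_size (insert a E) N. \<Prod>e\<in>#M. y e) =
        (\<Sum>(i, M)\<in>(SIGMA i:{0..N}. multisets_of_size E (N - i)). \<Prod>e\<in>#(M + replicate_mset i a). y e)"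
      using sum.reindex_bij_betw[OF bij_betw_multisets_of_size_insert[OF insert.hyps(2), of N],
          of "\<lambda>M. \<Prod>e\<in>#M. y e"] by (simp add: case_prod_beta)
    also have "\<dots> = (\<Sum>i\<in>{0..N}. \<Sum>M\<in>multisets_of_size E (N - i). \<Prod>e\<in>#(M + replicate_mset i a). y e)"
      using insert.hyps by (intro sum.Sigma[symmetric]) (auto intro: finite_multisets_of_size)
    also have "\<dots> = (\<Sum>i\<le>N. y a ^ i * H (N - i))"
      by (simp add: H_def sum_distrib_left mult.commute atLeast0AtMost)
    finally show ?thesis
      by (auto simp: sum_distrib_left power_mult_distrib intro!: sum.cong simp flip: power_add)
  qed
  then show ?case
    using Cauchy_product_sums[OF abs_geo abs] IH[of z] geo insert.hyps insert.prems
    by (simp add: sums_iff)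
qed

text \<open>
  The majorant for the interchange of sum and integral: the case of the generating function in
  which all variables are \<open>1\<close>.
\<close>

lemma multisets_of_size_powser_summable:
  assumes "finite E" "\<bar>x\<bar> < (1::real)"
  shows "summable (\<lambda>N. x ^ N * real (card (multisets_of_size E N)))"
proof -
  have "(\<lambda>N. complex_of_real (x ^ N * real (card (multisets_of_size E N)))) sums (\<Prod>e\<in>E. 1 / (1 - of_real x))"
    using complete_homogeneous_sums[OF assms(1), of "\<lambda>_. 1" "of_real x"] assms(2) by simp
  then have "summable (\<lambda>N. complex_of_real (x ^ N * real (card (multisets_of_size E N))))"
    by (rule sums_summable)
  then show ?thesis by (simp only: summable_complex_of_real)
qed

lemma has_bochner_integral_circle_character:
  "has_bochner_integral lborel
    (\<lambda>s. indicator {0..<2 * pi} s *\<^sub>R exp (\<i> * (of_int k * complex_of_real s)))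
    (if k = 0 then 2 * of_real pi else 0)"
proof -
  let ?f = "\<lambda>s. exp (\<i> * (of_int k * complex_of_real s))"
  define F where "F s = (if k = 0 then complex_of_real s else ?f s / (\<i> * of_int k))" for s :: real
  have "(F has_vector_derivative ?f s) (at s within {0..2 * pi})" for s
  proof (cases "k = 0")
    case True
    then show ?thesis unfolding F_def by (auto intro!: derivative_eq_intros)
  next
    case False
    have "- (\<i> * (X * \<i>)) = X" for X by (simp add: mult.commute[of X])
    then have "((\<lambda>w. exp (\<i> * (of_int k * w)) / (\<i> * of_int k)) has_field_derivative ?f s) (at (of_real s))"
      using False by (auto intro!: derivative_eq_intros)
    from has_vector_derivative_real_field[OF this] False show ?thesis
      unfolding F_def by (simp add: has_vector_derivative_at_within)
  qed
  then have "has_bochner_integral lborel (\<lambda>s. indicator {0..2 * pi} s *\<^sub>R ?f s) (F (2 * pi) - F 0)"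
    by (intro has_bochner_integral_FTC_Icc continuous_intros) auto
  moreover have "F (2 * pi) - F 0 = (if k = 0 then 2 * of_real pi else 0)"
  proof (cases "k = 0")
    case False
    have "?f (2 * pi) = exp ((2 * of_int k * of_real pi) * \<i>)"
      by (simp add: mult_ac)
    also have "\<dots> = 1" using exp_integer_2pi[of "of_int k"] by simp
    finally show ?thesis using False by (simp add: F_def)
  qed (simp add: F_def)
  \<comment> \<open>The fundamental theorem of calculus gives the integral over the closed interval, which differs
    from the half-open one by a null set.\<close>
  moreover have "has_bochner_integral lborel (\<lambda>s. indicator {0..2 * pi} s *\<^sub>R ?f s) x =
      has_bochner_integral lborel (\<lambda>s. indicator {0..<2 * pi} s *\<^sub>R ?f s) x" for x
    by (rule has_bochner_integral_discrete_difference[where X = "{2 * pi}"])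
      (auto simp: indicator_def)
  ultimately show ?thesis by simp
qed

abbreviation torus_box :: "nat \<Rightarrow> (nat \<Rightarrow> real) set"
  where "torus_box r \<equiv> PiE {..<r} (\<lambda>_. {0..<2 * pi})"

abbreviation torus_measure :: "nat \<Rightarrow> (nat \<Rightarrow> real) measure"
  where "torus_measure r \<equiv> PiM {..<r} (\<lambda>_. lborel)"

definition torus_character :: "nat \<Rightarrow> (nat \<Rightarrow> int) \<Rightarrow> (nat \<Rightarrow> real) \<Rightarrow> complex"
  where "torus_character r k t = exp (\<i> * (\<Sum>i<r. of_int (k i) * complex_of_real (t i)))"

lemma norm_torus_character: "norm (torus_character r k t) = 1"
proof -
  have "torus_character r k t = exp (\<i> * complex_of_real (\<Sum>i<r. of_int (k i) * t i))"
    by (simp add: torus_character_def)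
  then show ?thesis by (simp only: norm_exp_i_times)
qed

text \<open>
  Orthogonality of characters, in the form that the integral of a nontrivial one vanishes. The
  integrand is a product of functions of one coordinate each, so the integral is a product too.
\<close>

lemma torus_character_integral:
  shows "set_integrable (torus_measure r) (torus_box r) (torus_character r k)"
    and "(LINT t:torus_box r|torus_measure r. torus_character r k t) =
      (if \<forall>i<r. k i = 0 then (2 * of_real pi) ^ r else 0)"
proof -
  interpret product_sigma_finite "\<lambda>_::nat. lborel :: real measure"
    by unfold_locales
  let ?f = "\<lambda>k s. indicator {0..<2 * pi} s *\<^sub>R exp (\<i> * (of_int k * complex_of_real s))"
  have int: "integrable lborel (?f (k i))" for i
    using has_bochner_integral_circle_character by (auto simp: has_bochner_integral_iff)
  have eq: "indicator (torus_box r) t *\<^sub>R torus_character r k t = (\<Prod>i<r. ?f (k i) (t i))"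
    if "t \<in> space (torus_measure r)" for t
  proof -
    have "indicator (torus_box r) t = (\<Prod>i<r. indicator {0..<2 * pi} (t i) :: real)"
      using that by (auto simp: indicator_def space_PiM PiE_iff prod_zero_iff)
    then show ?thesis
      by (simp add: torus_character_def sum_distrib_left exp_sum scaleR_conv_of_real prod.distrib)
  qed
  show "set_integrable (torus_measure r) (torus_box r) (torus_character r k)"
    unfolding set_integrable_def
    using product_integrable_prod[of "{..<r}" "\<lambda>i. ?f (k i)"] int
    by (subst Bochner_Integration.integrable_cong[OF refl eq]) auto
  have "(LINT t:torus_box r|torus_measure r. torus_character r k t) =
      (\<integral>t. (\<Prod>i<r. ?f (k i) (t i)) \<partial>torus_measure r)"
    unfolding set_lebesgue_integral_def by (rule Bochner_Integration.integral_cong[OF refl eq])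
  also have "\<dots> = (\<Prod>i<r. integral\<^sup>L lborel (?f (k i)))"
    using int by (intro product_integral_prod) auto
  also have "\<dots> = (\<Prod>i<r. if k i = 0 then 2 * of_real pi else 0)"
    by (intro prod.cong refl has_bochner_integral_integral_eq has_bochner_integral_circle_character)
  also have "\<dots> = (if \<forall>i<r. k i = 0 then (2 * of_real pi) ^ r else 0)"
  proof (cases "\<forall>i<r. k i = 0")
    case False
    then obtain i where "i < r" "k i \<noteq> 0" by blast
    with False show ?thesis by (simp only: if_False) (intro prod_zero; force)
  qed simp
  finally show "(LINT t:torus_box r|torus_measure r. torus_character r k t) =
      (if \<forall>i<r. k i = 0 then (2 * of_real pi) ^ r else 0)" .
qed

text \<open>
  Integrating termwise extracts the constant Fourier coefficient: every trivial character
  contributes the volume of the torus, and the others contribute nothing. Since characters have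
  modulus \<open>1\<close>, dominated convergence only asks for the growth of the number of terms.
\<close>

lemma torus_integral_character_series:
  fixes k :: "'a \<Rightarrow> nat \<Rightarrow> int" and z :: complex
  assumes fin: "\<And>N. finite (S N)" and sum: "summable (\<lambda>N. norm z ^ N * real (card (S N)))"
  shows "(LINT t:torus_box r|torus_measure r. suminf (\<lambda>N. z ^ N * (\<Sum>M\<in>S N. torus_character r (k M) t))) =
    (2 * of_real pi) ^ r * suminf (\<lambda>N. z ^ N * of_nat (card {M \<in> S N. \<forall>i<r. k M i = 0}))"
proof -
  let ?m = "torus_measure r" and ?A = "torus_box r"
  define f where "f N t = z ^ N * (\<Sum>M\<in>S N. torus_character r (k M) t)" for N t
  have int: "integrable ?m (\<lambda>t. indicator ?A t *\<^sub>R f N t)" for N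
    unfolding f_def using torus_character_integral(1)[unfolded set_integrable_def]
    by (simp add: scaleR_sum_right flip: mult_scaleR_right)
  have val: "(\<integral>t. indicator ?A t *\<^sub>R f N t \<partial>?m) =
      (2 * of_real pi) ^ r * (z ^ N * of_nat (card {M \<in> S N. \<forall>i<r. k M i = 0}))" for N
  proof -
    have "(\<integral>t. indicator ?A t *\<^sub>R f N t \<partial>?m) =
        (\<integral>t. z ^ N * (\<Sum>M\<in>S N. indicator ?A t *\<^sub>R torus_character r (k M) t) \<partial>?m)"
      by (rule Bochner_Integration.integral_cong[OF refl])
        (simp add: f_def sum_distrib_left scaleR_sum_right)
    also have "\<dots> = z ^ N * (\<Sum>M\<in>S N. \<integral>t. indicator ?A t *\<^sub>R torus_character r (k M) t \<partial>?m)"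
      using torus_character_integral(1)[unfolded set_integrable_def] by simp
    also have "\<dots> = z ^ N * (\<Sum>M\<in>S N. if \<forall>i<r. k M i = 0 then (2 * of_real pi) ^ r else 0)"
      using torus_character_integral(2)[unfolded set_lebesgue_integral_def] by simp
    also have "\<dots> = (2 * of_real pi) ^ r * (z ^ N * of_nat (card {M \<in> S N. \<forall>i<r. k M i = 0}))"
      using fin[of N] by (simp add: sum.If_cases Int_def)
    finally show ?thesis .
  qed
  have bound: "norm (f N t) \<le> norm z ^ N * real (card (S N))" for N t
  proof -
    have "norm (\<Sum>M\<in>S N. torus_character r (k M) t) \<le> real (card (S N))"
      using norm_sum[of "\<lambda>M. torus_character r (k M) t" "S N"] by (simp add: norm_torus_character)
    then show ?thesis by (simp add: f_def norm_mult norm_power mult_left_mono)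
  qed
  have ind: "integrable ?m (\<lambda>t. indicator ?A t :: real)"
    using integrable_norm[OF torus_character_integral(1)[unfolded set_integrable_def, of r "\<lambda>_. 0"]]
    by (simp add: norm_torus_character)
  have sum_norm: "summable (\<lambda>N. norm (f N t))" for t
    using bound by (intro summable_comparison_test'[OF sum, of 0]) auto
  have "summable (\<lambda>N. \<integral>t. norm (indicator ?A t *\<^sub>R f N t) \<partial>?m)"
  proof (rule summable_comparison_test')
    show "summable (\<lambda>N. norm z ^ N * real (card (S N)) * (\<integral>t. indicator ?A t \<partial>?m))"
      using sum by (rule summable_mult2)
    fix N
    have "(\<integral>t. norm (indicator ?A t *\<^sub>R f N t) \<partial>?m)
        \<le> (\<integral>t. norm z ^ N * real (card (S N)) * indicator ?A t \<partial>?m)"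
      using bound ind int by (intro integral_mono integrable_norm) (auto simp: indicator_def)
    also have "\<dots> = norm z ^ N * real (card (S N)) * (\<integral>t. indicator ?A t \<partial>?m)"
      by (rule integral_mult_right_zero)
    finally show "norm (\<integral>t. norm (indicator ?A t *\<^sub>R f N t) \<partial>?m)
        \<le> norm z ^ N * real (card (S N)) * (\<integral>t. indicator ?A t \<partial>?m)"
      by (simp add: Bochner_Integration.integral_nonneg)
  qed
  then have "(\<integral>t. suminf (\<lambda>N. indicator ?A t *\<^sub>R f N t) \<partial>?m) = suminf (\<lambda>N. \<integral>t. indicator ?A t *\<^sub>R f N t \<partial>?m)"
    using sum_norm by (intro integral_suminf int) (auto intro!: summable_mult)
  moreover have "suminf (\<lambda>N. indicator ?A t *\<^sub>R f N t) = indicator ?A t *\<^sub>R suminf (\<lambda>N. f N t)" for t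
    by (cases "t \<in> ?A") auto
  moreover have "summable (\<lambda>N. z ^ N * of_nat (card {M \<in> S N. \<forall>i<r. k M i = 0}))"
  proof (rule summable_comparison_test'[OF sum])
    fix N show "norm (z ^ N * of_nat (card {M \<in> S N. \<forall>i<r. k M i = 0})) \<le> norm z ^ N * real (card (S N))"
      using fin by (auto simp: norm_mult norm_power intro!: mult_left_mono card_mono)
  qed
  ultimately show ?thesis
    by (simp add: set_lebesgue_integral_def val suminf_mult flip: f_def)
qed

lemma power_series_unit_disc:
  fixes a :: "nat \<Rightarrow> complex"
  assumes "\<And>z. norm z < 1 \<Longrightarrow> summable (\<lambda>n. a n * z ^ n)" and "R < 1"
  shows "(\<lambda>z. suminf (\<lambda>n. a n * z ^ n)) analytic_on cball 0 R"
proof -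
  have "(\<lambda>z. suminf (\<lambda>n. a n * z ^ n)) holomorphic_on ball 0 1"
    using termdiffs_strong'[where K = 1, OF assms(1)] by (subst holomorphic_on_open) fastforce+
  then have "(\<lambda>z. suminf (\<lambda>n. a n * z ^ n)) analytic_on ball 0 1" by (simp add: analytic_on_open)
  then show ?thesis by (rule analytic_on_subset) (use assms(2) in auto)
qed


section \<open>Weight multiplicities as an integral over the torus\<close>

lemma exp_weight_eq_torus_character:
  assumes "\<nu> \<in> dual_space h" "complex_vector.subspace h" "\<And>i. i < r \<Longrightarrow> c i \<in> h"
    and "\<And>i. i < r \<Longrightarrow> of_int (k i) = \<nu> (c i)"
  shows "exp (\<i> * \<nu> (\<Sum>i<r. of_real (t i) *\<^sub>C c i)) = torus_character r k t"
  using assms by (subst dual_space_sum[OF assms(1,2)]) (auto simp: torus_character_def mult.commute)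

text \<open>
  Grouping the basis vectors by their weights turns the product over the basis into a product over
  the weights, each with its multiplicity.
\<close>

lemma prod_weight_mult_one:
  fixes g :: "('g \<Rightarrow> complex) \<Rightarrow> complex"
  assumes "finite E" and X: "\<And>e. e \<in> E \<Longrightarrow> wt e \<in> X"
    and mult: "\<And>\<nu>. \<nu> \<in> X \<Longrightarrow>
      weight_mult h \<rho> 1 \<nu> = card {M \<in> multisets_of_size E 1. (\<lambda>x. \<Sum>e\<in>#M. wt e x) = \<nu>}"
  shows "(\<Prod>\<nu> | \<nu> \<in> X \<and> weight_mult h \<rho> 1 \<nu> \<noteq> 0. 1 / g \<nu> ^ weight_mult h \<rho> 1 \<nu>) = (\<Prod>e\<in>E. 1 / g (wt e))"
proof -
  have m1: "weight_mult h \<rho> 1 \<nu> = card {e \<in> E. wt e = \<nu>}" if "\<nu> \<in> X" for \<nu>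
  proof -
    have eq: "{M \<in> multisets_of_size E 1. (\<lambda>x. \<Sum>e\<in>#M. wt e x) = \<nu>} = (\<lambda>e. {#e#}) ` {e \<in> E. wt e = \<nu>}"
    proof (intro equalityI subsetI)
      fix M assume M: "M \<in> {M \<in> multisets_of_size E 1. (\<lambda>x. \<Sum>e\<in>#M. wt e x) = \<nu>}"
      then obtain e where "M = {#e#}"
        using size_1_singleton_mset[of M] by (auto simp: multisets_of_size_def)
      with M show "M \<in> (\<lambda>e. {#e#}) ` {e \<in> E. wt e = \<nu>}" by (auto simp: multisets_of_size_def)
    qed (auto simp: multisets_of_size_def)
    show ?thesis unfolding mult[OF that] eq by (rule card_image) (simp add: inj_on_def)
  qed
  have set: "{\<nu> \<in> X. weight_mult h \<rho> 1 \<nu> \<noteq> 0} = wt ` E"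
    using assms(1) X by (auto simp: m1 card_gt_0_iff simp del: One_nat_def)
  have "(\<Prod>e\<in>E. 1 / g (wt e)) = (\<Prod>\<nu>\<in>wt ` E. \<Prod>e | e \<in> E \<and> wt e = \<nu>. 1 / g (wt e))"
    using assms(1) by (rule prod.image_gen)
  also have "\<dots> = (\<Prod>\<nu>\<in>wt ` E. 1 / g \<nu> ^ weight_mult h \<rho> 1 \<nu>)"
    using X by (intro prod.cong) (auto simp: m1 power_one_over simp del: One_nat_def)
  finally show ?thesis unfolding set by (rule sym)
qed

theorem proposition4p1:
  fixes h b :: "'g::lie_algebra set"
    and r :: nat
    and \<alpha> :: "nat \<Rightarrow> 'g \<Rightarrow> complex"
    and \<alpha>c :: "nat \<Rightarrow> 'g"
    and \<omega> :: "nat \<Rightarrow> 'g \<Rightarrow> complex"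
    and \<rho> :: "'g \<Rightarrow> 'v::complex_vector \<Rightarrow> 'v"
    and lam \<mu> :: "'g \<Rightarrow> complex"
  assumes "semisimple TYPE('g)"
    and "cartan_subalgebra h" and "complex_vector.dim h = r"
    and "borel_subalgebra b" and "h \<subseteq> b"
    and "bij_betw \<alpha> {..<r} (simple_roots h b)"
    and "\<forall>i<r. is_coroot h (\<alpha> i) (\<alpha>c i)"
    and "fundamental_weights h r \<alpha>c \<omega>"
    and "finite_dim (UNIV :: 'v set)" and "irreducible_rep \<rho>"
    and "lam \<in> dominant_weights r \<omega>" and "highest_weight h b \<rho> lam"
    and "\<mu> \<in> weight_lattice r \<omega>"
  shows "(\<forall>R<1.
        (\<forall>z\<in>cball (0::complex) R. summable (\<lambda>N. z ^ N * of_nat (weight_mult h \<rho> N \<mu>))) \<and>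
        (\<lambda>z::complex. suminf (\<lambda>N. z ^ N * of_nat (weight_mult h \<rho> N \<mu>))) analytic_on cball 0 R) \<and>
    (\<forall>z::complex. norm z < 1 \<longrightarrow>
        (suminf (\<lambda>N. z ^ N * of_nat (weight_mult h \<rho> N \<mu>))) =
        1 / (2 * of_real pi) ^ r * torus_integral r \<alpha>c (\<lambda>x. exp (- \<i> * \<mu> x) *
          (\<Prod>\<nu> | \<nu> \<in> weight_lattice r \<omega> \<and> weight_mult h \<rho> 1 \<nu> \<noteq> 0.
            1 / (1 - exp (\<i> * \<nu> x) * z) ^ weight_mult h \<rho> 1 \<nu>)))"
proof -
  note fw = \<open>fundamental_weights h r \<alpha>c \<omega>\<close>
  have fing: "finite_dim (UNIV :: 'g set)" using assms(1) by (simp add: semisimple_def)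
  have toral: "toral h" using assms(2) by (simp add: cartan_subalgebra_def)
  have h: "complex_vector.subspace h" using toral by (simp add: toral_def)
  have c: "\<alpha>c i \<in> h" if "i < r" for i using assms(7) that by (auto simp: is_coroot_def)
  have dual: "\<nu> \<in> dual_space h" if "\<nu> \<in> weight_lattice r \<omega>" for \<nu>
    using weight_lattice_subset_dual_space[OF fw] that by blast
  have lam: "lam \<in> dual_space h"
    using dual dominant_weights_subset_weight_lattice assms(11) by blast
  obtain v where v: "v \<in> weight_space h \<rho> lam" "v \<noteq> 0"
    using assms(12) by (auto simp: highest_weight_def)
  obtain E wt where E: "finite E" "complex_vector.independent E" "complex_vector.span E = UNIV"
    and wt: "\<And>e. e \<in> E \<Longrightarrow> wt e \<in> weight_lattice r \<omega>" "\<And>e. e \<in> E \<Longrightarrow> e \<in> weight_space h \<rho> (wt e)"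
    using weight_basis_exists[OF fing toral assms(3) fw _ assms(9,10) lam v, of \<alpha>] assms(7) by blast
  define W where "W M = (\<lambda>x. \<Sum>e\<in>#M. wt e x)" for M
  let ?A = "multisets_of_size E"
  have rep: "lie_representation \<rho>" using assms(10) by (simp add: irreducible_rep_def)
  have mult: "weight_mult h \<rho> N \<nu> = card {M \<in> ?A N. W M = \<nu>}" if "\<nu> \<in> weight_lattice r \<omega>" for N \<nu>
    unfolding W_def using weight_mult_eq_card[OF E rep wt(2) dual[OF wt(1)] dual[OF that]] by simp
  have bound: "card {M \<in> ?A N. P M} \<le> card (?A N)" for N P
    by (rule card_mono[OF finite_multisets_of_size[OF E(1)]]) blast
  have summ: "summable (\<lambda>N. of_nat (weight_mult h \<rho> N \<mu>) * z ^ N)" if z: "norm z < 1" for z :: complex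
  proof (rule summable_comparison_test')
    show "summable (\<lambda>N. norm z ^ N * real (card (?A N)))"
      using z by (intro multisets_of_size_powser_summable E) simp
    show "norm (of_nat (weight_mult h \<rho> N \<mu>) * z ^ N) \<le> norm z ^ N * real (card (?A N))" for N
      using bound by (simp add: norm_mult norm_power mult[OF assms(13)] mult.commute mult_left_mono)
  qed
  have identity: "suminf (\<lambda>N. z ^ N * of_nat (weight_mult h \<rho> N \<mu>)) =
        1 / (2 * of_real pi) ^ r * torus_integral r \<alpha>c (\<lambda>x. exp (- \<i> * \<mu> x) *
          (\<Prod>\<nu> | \<nu> \<in> weight_lattice r \<omega> \<and> weight_mult h \<rho> 1 \<nu> \<noteq> 0.
            1 / (1 - exp (\<i> * \<nu> x) * z) ^ weight_mult h \<rho> 1 \<nu>))"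
    (is "_ = _ * torus_integral r \<alpha>c ?F") if z: "norm z < 1" for z :: complex
  proof -
    have Wdual: "W M \<in> dual_space h" if "M \<in> ?A N" for M N
      unfolding W_def using that wt(1) dual
      by (intro dual_space_sum_mset) (auto simp: multisets_of_size_def)
    have Wint: "W M (\<alpha>c i) \<in> \<int>" if "M \<in> ?A N" "i < r" for M N i
    proof -
      have "set_mset M \<subseteq> E \<Longrightarrow> (\<Sum>e\<in>#M. wt e (\<alpha>c i)) \<in> \<int>"
        using weight_lattice_integral[OF fw wt(1) \<open>i < r\<close>] by (induction M) auto
      then show ?thesis using that by (simp add: W_def multisets_of_size_def)
    qed
    \<comment> \<open>In the coordinates given by the coroots, \<open>W M - \<mu>\<close> is the character with exponents \<open>k M\<close>;
      it is trivial exactly for the monomials of weight \<open>\<mu>\<close>. The values are complex numbers that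
      are integers; the floor of the real part turns them into elements of type \<open>int\<close>.\<close>
    define k where "k M i = \<lfloor>Re (W M (\<alpha>c i) - \<mu> (\<alpha>c i))\<rfloor>" for M i
    have k: "of_int (k M i) = W M (\<alpha>c i) - \<mu> (\<alpha>c i)" if "M \<in> ?A N" "i < r" for M N i
    proof -
      note MA = that
      obtain n where "W M (\<alpha>c i) - \<mu> (\<alpha>c i) = of_int n"
        using Ints_diff[OF Wint[OF MA] weight_lattice_integral[OF fw assms(13) MA(2)]]
        by (auto elim!: Ints_cases)
      then show ?thesis unfolding k_def by (simp only: complex_Re_of_int floor_of_int)
    qed
    have k0: "(\<forall>i<r. k M i = 0) \<longleftrightarrow> W M = \<mu>" if M: "M \<in> ?A N" for M N
    proof
      assume "\<forall>i<r. k M i = 0"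
      then have "W M (\<alpha>c i) = \<mu> (\<alpha>c i)" if "i < r" for i using k[OF M that] that by simp
      from dual_space_eq_if_eq_on_coroots[OF fing h assms(3) fw c Wdual[OF M] dual[OF assms(13)] this]
      show "W M = \<mu>" .
    qed (simp add: k_def)
    \<comment> \<open>The integrand is the generating function of the monomials evaluated at the characters of
      the basis weights, shifted by \<open>-\<mu>\<close>.\<close>
    have expand: "?F (\<Sum>i<r. of_real (t i) *\<^sub>C \<alpha>c i) =
        suminf (\<lambda>N. z ^ N * (\<Sum>M\<in>?A N. torus_character r (k M) t))" for t
    proof -
      let ?x = "\<Sum>i<r. of_real (t i) *\<^sub>C \<alpha>c i"
      define y where "y e = exp (\<i> * wt e ?x)" for e
      have y1: "norm (y e) \<le> 1" if e: "e \<in> E" for e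
      proof -
        have "of_int \<lfloor>Re (wt e (\<alpha>c i))\<rfloor> = wt e (\<alpha>c i)" if "i < r" for i
          using weight_lattice_integral[OF fw wt(1)[OF e] that] by (auto elim!: Ints_cases)
        then have "y e = torus_character r (\<lambda>i. \<lfloor>Re (wt e (\<alpha>c i))\<rfloor>) t"
          unfolding y_def by (intro exp_weight_eq_torus_character[OF dual[OF wt(1)[OF e]] h c]) auto
        then show ?thesis by (simp add: norm_torus_character)
      qed
      have char: "exp (- \<i> * \<mu> ?x) * (\<Prod>e\<in>#M. y e) = torus_character r (k M) t" if M: "M \<in> ?A N" for M N
      proof -
        have "(\<Prod>e\<in>#M. y e) = exp (\<i> * W M ?x)"
          unfolding W_def by (induction M) (simp_all add: y_def exp_add distrib_left)
        then have "exp (- \<i> * \<mu> ?x) * (\<Prod>e\<in>#M. y e) = exp (\<i> * (W M ?x - \<mu> ?x))"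
          by (simp add: algebra_simps flip: exp_add)
        also have "\<dots> = torus_character r (k M) t"
          using Wdual[OF M] dual[OF assms(13)] k[OF M] c
          by (intro exp_weight_eq_torus_character[where \<nu> = "\<lambda>x. W M x - \<mu> x", OF _ h])
            (auto simp: dual_space_def algebra_simps)
        finally show ?thesis .
      qed
      have "?F ?x = exp (- \<i> * \<mu> ?x) * (\<Prod>e\<in>E. 1 / (1 - y e * z))"
        using prod_weight_mult_one[OF E(1) wt(1) mult[unfolded W_def], where g = "\<lambda>\<nu>. 1 - exp (\<i> * \<nu> ?x) * z"]
        by (simp add: y_def)
      also have "\<dots> = exp (- \<i> * \<mu> ?x) * suminf (\<lambda>N. z ^ N * (\<Sum>M\<in>?A N. \<Prod>e\<in>#M. y e))"
        using complete_homogeneous_sums[OF E(1) y1 z] by (simp add: sums_iff)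
      also have "\<dots> = suminf (\<lambda>N. exp (- \<i> * \<mu> ?x) * (z ^ N * (\<Sum>M\<in>?A N. \<Prod>e\<in>#M. y e)))"
        using complete_homogeneous_sums[OF E(1) y1 z] by (intro suminf_mult[symmetric]) (simp add: sums_iff)
      also have "\<dots> = suminf (\<lambda>N. z ^ N * (\<Sum>M\<in>?A N. torus_character r (k M) t))"
        by (simp only: mult.left_commute[of "exp _"] sum_distrib_left[of "exp _"] char cong: sum.cong)
      finally show ?thesis .
    qed
    have "torus_integral r \<alpha>c ?F =
        (LINT t:torus_box r|torus_measure r. suminf (\<lambda>N. z ^ N * (\<Sum>M\<in>?A N. torus_character r (k M) t)))"
      unfolding torus_integral_def expand ..
    also have "\<dots> = (2 * of_real pi) ^ r * suminf (\<lambda>N. z ^ N * of_nat (card {M \<in> ?A N. \<forall>i<r. k M i = 0}))"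
      using z by (intro torus_integral_character_series finite_multisets_of_size
          multisets_of_size_powser_summable E) simp
    also have "(\<lambda>N. card {M \<in> ?A N. \<forall>i<r. k M i = 0}) = (\<lambda>N. weight_mult h \<rho> N \<mu>)"
      using k0 by (intro ext) (auto simp: mult[OF assms(13)] intro!: arg_cong[where f = card])
    finally show ?thesis by simp
  qed
  show ?thesis
  proof (intro conjI allI impI ballI)
    fix R :: real and z :: complex assume "R < 1" "z \<in> cball 0 R"
    then show "summable (\<lambda>N. z ^ N * of_nat (weight_mult h \<rho> N \<mu>))"
      using summ[of z] by (simp add: mult.commute)
  next
    fix R :: real assume "R < 1"
    then show "(\<lambda>z::complex. suminf (\<lambda>N. z ^ N * of_nat (weight_mult h \<rho> N \<mu>))) analytic_on cball 0 R"
      using power_series_unit_disc[OF summ] by (simp add: mult.commute)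
  qed (rule identity)
qed

end
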